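(* With the functions and constants defined in the context, the following relations hold. (1) $$f_{34}(x)-\frac{C_1(x)}{S_3}=\frac{\check S_1+A_{1,2}K_{6,3}}{A_{1,1}S_3}\,y_{\beta_1}(x)-\frac{A_{1,2}}{A_{1,1}S_3}\,y_{\beta_2}(x),$$ where $$S_3=-\frac{(q^\lambda\alpha_1\alpha_2/(\beta_1\beta_2),q\alpha_1/\beta_1;q)_\infty}{(q^{\lambda+1}\alpha_1/\beta_1,\alpha_1\alpha_2/(\beta_1\beta_2);q)_\infty},$$ $$C_1(x)=x^\lambda\frac{(\beta_2/\alpha_1,q\beta_2/\alpha_2,q^\lambda,\alpha_1\alpha_2x/\beta_1;q)_\infty}{(q^{\lambda+1}\alpha_1/\beta_1,\beta_1\beta_2/(\alpha_1\alpha_2),\alpha_2/\beta_1,q^{-\lambda}\beta_2x;q)_\infty}\,{}_3\phi_2\left(\begin{array}{c}q^\lambda\alpha_1\alpha_2/(\beta_1\beta_2),q\alpha_1/\beta_1,\alpha_2/\beta_1\\ \alpha_1\alpha_2x/\beta_1,q\alpha_1\alpha_2/(\beta_1\beta_2)\end{array};q,q\right).$$ (2) $$f_{37}(x)-\frac{C_2(x)}{S_4}=\frac{S_1}{S_4}\,y_{\beta_2}(x),$$ where $$S_4=-\frac{(\beta_2/\alpha_1,\alpha_2/\beta_1;q)_\infty}{(q^\lambda\alpha_2/\beta_1,q^{-\lambda}\beta_2/\alpha_1;q)_\infty},$$ $$C_2(x)=x^\lambda\frac{(\alpha_1x,q^\lambda\alpha_1\alpha_2/(\beta_1\beta_2),q^\lambda,q\beta_2/\beta_1;q)_\infty}{(q^{\lambda+1}\alpha_1/\beta_1,q^\lambda\alpha_2/\beta_1,q^\lambda\alpha_1/\beta_2,q^{-\lambda}\beta_2x,\beta_2/\alpha_1,\alpha_2/\beta_1;q)_\infty}\,{}_3\phi_2\left(\begin{array}{c}\beta_2/\alpha_1,\alpha_2/\beta_1,q^{-\lambda}\beta_2x\\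 q\beta_2/\beta_1,q^{-\lambda+1}\beta_2/\alpha_1\end{array};q,q\right).$$ (3) $$f_{36}(x)-\frac{C_3(x)}{S_5(x)}=\frac{S_2(x)}{S_5(x)}\,y_x(x),$$ where $$S_5(x)=-\frac{(q^\lambda\alpha_1\alpha_2/(\beta_1\beta_2),q\alpha_1/\beta_1;q)_\infty\,\vartheta_q(q^{-\lambda}\beta_1x)\,\vartheta_q(\beta_2x/q)}{(q\alpha_1\alpha_2/(\beta_1\beta_2),q^\lambda\alpha_1/\beta_1;q)_\infty\,\vartheta_q(q^{-\lambda-1}\beta_1\beta_2x/\alpha_1)\,\vartheta_q(\alpha_1x)},$$ $$C_3(x)=x^\lambda\frac{(\alpha_2x/q,q^{-\lambda+1},\alpha_2/\beta_2;q)_\infty}{(q^{-\lambda-1}\beta_1\beta_2x/\alpha_1,q\alpha_1\alpha_2/(\beta_1\beta_2),q^{-\lambda}\beta_1/\alpha_1;q)_\infty}\,{}_3\phi_2\left(\begin{array}{c}q^{\lambda+1}/(\beta_1x),q^\lambda\alpha_1\alpha_2/(\beta_1\beta_2),q\alpha_1/\beta_1\\ q^{\lambda+2}\alpha_1/(\beta_1\beta_2x),q^{\lambda+1}\alpha_1/\beta_1\end{array};q,q\right).$$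
   Context: $q$ is a complex number with $0<|q|<1$. Notation: $(a;q)_n=\prod_{j=0}^{n-1}(1-q^ja)$, $(a;q)_\infty=\prod_{j=0}^\infty(1-q^ja)$, $(a_1,\dots,a_N;q)_n=\prod_i(a_i;q)_n$ (also for $n=\infty$), $\vartheta_q(t)=(t,q/t,q;q)_\infty$, and $${}_3\phi_2\left(\begin{array}{c}a_1,a_2,a_3\\ b_1,b_2\end{array};q,z\right)=\sum_{n=0}^\infty\frac{(a_1,a_2,a_3;q)_n}{(q;q)_n(b_1,b_2;q)_n}z^n.$$ The parameters $\alpha_1,\alpha_2,\beta_1,\beta_2$ are nonzero complex numbers and $\lambda,\mu'$ are complex numbers with $q^{\mu'}\alpha_1\alpha_2/(\beta_1\beta_2)=1$ and $|q^\lambda\alpha_1\alpha_2/(\beta_1\beta_2)|<1$. Integral solutions: $$y_{\beta_1}(x)=(1-q)\beta_1^{\lambda-\mu'}x^\lambda\frac{(\beta_1x,q,q\beta_1/\beta_2;q)_\infty}{(q^{-\lambda}\beta_1x,\beta_1/\alpha_1,q\beta_1/\alpha_2;q)_\infty}\,{}_3\phi_2\left(\begin{array}{c}q^{-\lambda}\beta_1x,\beta_1/\alpha_1,q\beta_1/\alpha_2\\ \beta_1x,q\beta_1/\beta_2\end{array};q,q^\lambda\frac{\alpha_1\alpha_2}{\beta_1\beta_2}\right),$$ $$y_{\beta_2}(x)=(1-q)\beta_2^{\lambda-\mu'}x^\lambda\frac{(\beta_2x,q,q\beta_2/\beta_1;q)_\infty}{(q^{-\lambda}\beta_2x,\beta_2/\alpha_1,q\beta_2/\alpha_2;q)_\infty}\,{}_3\phi_2\left(\begin{array}{c}q^{-\lambda}\beta_2x,\beta_2/\alpha_1,q\beta_2/\alpha_2\\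 \beta_2x,q\beta_2/\beta_1\end{array};q,q^\lambda\frac{\alpha_1\alpha_2}{\beta_1\beta_2}\right),$$ $$y_x(x)=(1-q)q^{\lambda-\mu'}x^{\mu'}\frac{(q^2/(\beta_1x),q^2/(\beta_2x),q;q)_\infty}{(q/(\alpha_1x),q^2/(\alpha_2x),q^{-\lambda+1};q)_\infty}\,{}_3\phi_2\left(\begin{array}{c}q^{-\lambda+1},q/(\alpha_1x),q^2/(\alpha_2x)\\ q^2/(\beta_1x),q^2/(\beta_2x)\end{array};q,q^\lambda\frac{\alpha_1\alpha_2}{\beta_1\beta_2}\right).$$ Fujii–Nobukawa type functions: $$f_{34}(x)=x^\lambda\frac{(\beta_2x;q)_\infty}{(q^{-\lambda}\beta_2x;q)_\infty}\,{}_3\phi_2\left(\begin{array}{c}\beta_2/\alpha_1,q\beta_2/\alpha_2,q^\lambda\\ q\beta_1\beta_2/(\alpha_1\alpha_2),\beta_2x\end{array};q,q\right),$$ $$f_{36}(x)=x^\lambda\frac{(\alpha_1x,\alpha_2x/q;q)_\infty}{(\beta_2x/q,q^{-\lambda}\beta_1x;q)_\infty}\,{}_3\phi_2\left(\begin{array}{c}q^{-\lambda+1},\alpha_2/\beta_2,q/(\alpha_1x)\\ q^{-\lambda+1}\beta_1/\alpha_1,q^2/(\beta_2x)\end{array};q,q\right),$$ $$f_{37}(x)=x^\lambda\,{}_3\phi_2\left(\begin{array}{c}q^\lambda\alpha_1\alpha_2/(\beta_1\beta_2),q^\lambda,\alpha_1x\\ q^{\lambda+1}\alpha_1/\beta_1,q^{\lambda+1}\alpha_1/\beta_2\end{array};q,q\right).$$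 Coefficients: $$S_1=\frac{\beta_2^{-\lambda+\mu'}}{1-q}\frac{(q^\lambda\alpha_1\alpha_2/(\beta_1\beta_2),\beta_2/\alpha_1,q\beta_2/\alpha_2;q)_\infty}{(q^{\lambda+1}\alpha_1/\beta_1,q^\lambda\alpha_2/\beta_1,q;q)_\infty},$$ and $\check S_1$ is $S_1$ with $\beta_1$ and $\beta_2$ interchanged, that is, $$\check S_1=\frac{\beta_1^{-\lambda+\mu'}}{1-q}\frac{(q^\lambda\alpha_1\alpha_2/(\beta_1\beta_2),\beta_1/\alpha_1,q\beta_1/\alpha_2;q)_\infty}{(q^{\lambda+1}\alpha_1/\beta_2,q^\lambda\alpha_2/\beta_2,q;q)_\infty},$$ $$S_2(x)=\frac{q^{-\lambda+\mu'}}{1-q}\frac{(q^\lambda\alpha_1\alpha_2/(\beta_1\beta_2),q^{-\lambda+1};q)_\infty\,\vartheta_q(\alpha_2x/q)}{(q\alpha_1\alpha_2/(\beta_1\beta_2),q;q)_\infty\,\vartheta_q(q^{-\lambda-1}\beta_1\beta_2x/\alpha_1)}\,x^{\lambda-\mu'},$$ $$A_{1,1}=\frac{(\beta_1/\alpha_1,\alpha_2/\beta_2,q^{-\lambda}\beta_2/\alpha_1;q)_\infty}{(q^\lambda\alpha_2/\beta_2,\beta_2/\alpha_1,q^{-\lambda}\beta_1/\alpha_1;q)_\infty},$$ $$A_{1,2}=-\frac{\beta_2^{-\lambda+\mu'}}{1-q}\frac{(q^{-\lambda}\beta_2/\alpha_1,q^\lambda\alpha_1\alpha_2/(\beta_1\beta_2),q\beta_2/\alpha_2,\beta_1/\alpha_1,\alpha_2/\beta_2;q)_\infty}{(q^\lambda\alpha_2/\beta_2,\alpha_2/\beta_1,q^{-\lambda}\beta_1/\alpha_1,q^{\lambda+1}\alpha_1/\beta_1,q;q)_\infty},$$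 $$K_{6,3}=-\left(\frac{\beta_2}{\beta_1}\right)^{\lambda-\mu'}\frac{\vartheta_q(\beta_1/\beta_2)\vartheta_q(\alpha_2/\beta_1)\vartheta_q(q^\lambda\alpha_1/\beta_1)}{\vartheta_q(\beta_2/\beta_1)\vartheta_q(\alpha_2/\beta_2)\vartheta_q(q^\lambda\alpha_1/\beta_2)}.$$
   Formalization: As printed the relations are false: here the right-hand side of each of (1), (2), (3) is negated, and the factors β2/α1 and α2/β1 are removed from the denominator of the prefactor of C_2; each relation assumes that the denominators occurring in it do not vanish. *)

theory Defs
  imports "HOL-Analysis.Analysis"
begin

section \<open>Basic hypergeometric notation\<close>

definition qpoch :: "complex \<Rightarrow> complex \<Rightarrow> nat \<Rightarrow> complex" where
  "qpoch q a n = (\<Prod>j<n. 1 - q ^ j * a)"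

definition qpoch_inf :: "complex \<Rightarrow> complex \<Rightarrow> complex" where
  "qpoch_inf q a = (\<Prod>j. 1 - q ^ j * a)"

definition qpochs :: "complex \<Rightarrow> complex list \<Rightarrow> nat \<Rightarrow> complex" where
  "qpochs q as n = (\<Prod>a\<leftarrow>as. qpoch q a n)"

definition qpochs_inf :: "complex \<Rightarrow> complex list \<Rightarrow> complex" where
  "qpochs_inf q as = (\<Prod>a\<leftarrow>as. qpoch_inf q a)"

definition qtheta :: "complex \<Rightarrow> complex \<Rightarrow> complex" where
  "qtheta q t = qpochs_inf q [t, q / t, q]"

definition phi32 ::
  "complex \<Rightarrow> complex \<Rightarrow> complex \<Rightarrow> complex \<Rightarrow> complex \<Rightarrow> complex \<Rightarrow> complex \<Rightarrow> complex" where
  "phi32 a1 a2 a3 b1 b2 q z =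
     (\<Sum>n. qpochs q [a1, a2, a3] n / (qpoch q q n * qpochs q [b1, b2] n) * z ^ n)"


section \<open>Complex powers\<close>

text \<open>
  The powers of \<open>q\<close>, \<open>\<beta>1\<close>, \<open>\<beta>2\<close> and \<open>x\<close> are multivalued. All of them are taken with respect
  to one choice \<open>L z\<close> of a logarithm for every nonzero \<open>z\<close>. No continuity is asked of \<open>L\<close>, so every
  determination of the logarithms is covered; for \<open>L = Ln\<close> one has \<open>cpow L z s = z powr s\<close>.
\<close>

definition log_choice :: "(complex \<Rightarrow> complex) \<Rightarrow> bool" where
  "log_choice L \<longleftrightarrow> (\<forall>z. z \<noteq> 0 \<longrightarrow> exp (L z) = z)"

definition cpow :: "(complex \<Rightarrow> complex) \<Rightarrow> complex \<Rightarrow> complex \<Rightarrow> complex" where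
  "cpow L z s = exp (s * L z)"


section \<open>Integral solutions\<close>

text \<open>
  \<open>y_beta L q \<alpha>1 \<alpha>2 \<beta> \<beta>' \<lambda> \<mu>' x\<close> is \<open>y\<^sub>\<beta>(x)\<close>, where \<open>\<beta>'\<close> is the other one of
  \<open>\<beta>1\<close>, \<open>\<beta>2\<close>; the two integral solutions \<open>y\<^bsub>\<beta>1\<^esub>\<close> and \<open>y\<^bsub>\<beta>2\<^esub>\<close> differ by this interchange only.
\<close>

definition y_beta ::
  "(complex \<Rightarrow> complex) \<Rightarrow> complex \<Rightarrow> complex \<Rightarrow> complex \<Rightarrow> complex \<Rightarrow> complex \<Rightarrow>
   complex \<Rightarrow> complex \<Rightarrow> complex \<Rightarrow> complex" where
  "y_beta L q \<alpha>1 \<alpha>2 \<beta> \<beta>' lam \<mu>' x =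
     (1 - q) * cpow L \<beta> (lam - \<mu>') * cpow L x lam
     * (qpochs_inf q [\<beta> * x, q, q * \<beta> / \<beta>']
        / qpochs_inf q [cpow L q (- lam) * \<beta> * x, \<beta> / \<alpha>1, q * \<beta> / \<alpha>2])
     * phi32 (cpow L q (- lam) * \<beta> * x) (\<beta> / \<alpha>1) (q * \<beta> / \<alpha>2) (\<beta> * x) (q * \<beta> / \<beta>')
         q (cpow L q lam * \<alpha>1 * \<alpha>2 / (\<beta> * \<beta>'))"

definition y_x ::
  "(complex \<Rightarrow> complex) \<Rightarrow> complex \<Rightarrow> complex \<Rightarrow> complex \<Rightarrow> complex \<Rightarrow> complex \<Rightarrow>
   complex \<Rightarrow> complex \<Rightarrow> complex \<Rightarrow> complex" where
  "y_x L q \<alpha>1 \<alpha>2 \<beta>1 \<beta>2 lam \<mu>' x =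
     (1 - q) * cpow L q (lam - \<mu>') * cpow L x \<mu>'
     * (qpochs_inf q [q\<^sup>2 / (\<beta>1 * x), q\<^sup>2 / (\<beta>2 * x), q]
        / qpochs_inf q [q / (\<alpha>1 * x), q\<^sup>2 / (\<alpha>2 * x), cpow L q (- lam + 1)])
     * phi32 (cpow L q (- lam + 1)) (q / (\<alpha>1 * x)) (q\<^sup>2 / (\<alpha>2 * x))
         (q\<^sup>2 / (\<beta>1 * x)) (q\<^sup>2 / (\<beta>2 * x))
         q (cpow L q lam * \<alpha>1 * \<alpha>2 / (\<beta>1 * \<beta>2))"


section \<open>Fujii--Nobukawa type functions\<close>

definition f34 ::
  "(complex \<Rightarrow> complex) \<Rightarrow> complex \<Rightarrow> complex \<Rightarrow> complex \<Rightarrow> complex \<Rightarrow> complex \<Rightarrow>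
   complex \<Rightarrow> complex \<Rightarrow> complex" where
  "f34 L q \<alpha>1 \<alpha>2 \<beta>1 \<beta>2 lam x =
     cpow L x lam * (qpoch_inf q (\<beta>2 * x) / qpoch_inf q (cpow L q (- lam) * \<beta>2 * x))
     * phi32 (\<beta>2 / \<alpha>1) (q * \<beta>2 / \<alpha>2) (cpow L q lam)
         (q * \<beta>1 * \<beta>2 / (\<alpha>1 * \<alpha>2)) (\<beta>2 * x) q q"

definition f36 ::
  "(complex \<Rightarrow> complex) \<Rightarrow> complex \<Rightarrow> complex \<Rightarrow> complex \<Rightarrow> complex \<Rightarrow> complex \<Rightarrow>
   complex \<Rightarrow> complex \<Rightarrow> complex" where
  "f36 L q \<alpha>1 \<alpha>2 \<beta>1 \<beta>2 lam x =
     cpow L x lam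
     * (qpochs_inf q [\<alpha>1 * x, \<alpha>2 * x / q]
        / qpochs_inf q [\<beta>2 * x / q, cpow L q (- lam) * \<beta>1 * x])
     * phi32 (cpow L q (- lam + 1)) (\<alpha>2 / \<beta>2) (q / (\<alpha>1 * x))
         (cpow L q (- lam + 1) * \<beta>1 / \<alpha>1) (q\<^sup>2 / (\<beta>2 * x)) q q"

definition f37 ::
  "(complex \<Rightarrow> complex) \<Rightarrow> complex \<Rightarrow> complex \<Rightarrow> complex \<Rightarrow> complex \<Rightarrow> complex \<Rightarrow>
   complex \<Rightarrow> complex \<Rightarrow> complex" where
  "f37 L q \<alpha>1 \<alpha>2 \<beta>1 \<beta>2 lam x =
     cpow L x lam
     * phi32 (cpow L q lam * \<alpha>1 * \<alpha>2 / (\<beta>1 * \<beta>2)) (cpow L q lam) (\<alpha>1 * x)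
         (cpow L q (lam + 1) * \<alpha>1 / \<beta>1) (cpow L q (lam + 1) * \<alpha>1 / \<beta>2) q q"


section \<open>Connection coefficients\<close>

definition S1 ::
  "(complex \<Rightarrow> complex) \<Rightarrow> complex \<Rightarrow> complex \<Rightarrow> complex \<Rightarrow> complex \<Rightarrow> complex \<Rightarrow>
   complex \<Rightarrow> complex \<Rightarrow> complex" where
  "S1 L q \<alpha>1 \<alpha>2 \<beta>1 \<beta>2 lam \<mu>' =
     cpow L \<beta>2 (- lam + \<mu>') / (1 - q)
     * (qpochs_inf q [cpow L q lam * \<alpha>1 * \<alpha>2 / (\<beta>1 * \<beta>2), \<beta>2 / \<alpha>1, q * \<beta>2 / \<alpha>2]
        / qpochs_inf q [cpow L q (lam + 1) * \<alpha>1 / \<beta>1, cpow L q lam * \<alpha>2 / \<beta>1, q])"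

definition S1_check ::
  "(complex \<Rightarrow> complex) \<Rightarrow> complex \<Rightarrow> complex \<Rightarrow> complex \<Rightarrow> complex \<Rightarrow> complex \<Rightarrow>
   complex \<Rightarrow> complex \<Rightarrow> complex" where
  "S1_check L q \<alpha>1 \<alpha>2 \<beta>1 \<beta>2 lam \<mu>' = S1 L q \<alpha>1 \<alpha>2 \<beta>2 \<beta>1 lam \<mu>'"

definition S2 ::
  "(complex \<Rightarrow> complex) \<Rightarrow> complex \<Rightarrow> complex \<Rightarrow> complex \<Rightarrow> complex \<Rightarrow> complex \<Rightarrow>
   complex \<Rightarrow> complex \<Rightarrow> complex \<Rightarrow> complex" where
  "S2 L q \<alpha>1 \<alpha>2 \<beta>1 \<beta>2 lam \<mu>' x =
     cpow L q (- lam + \<mu>') / (1 - q)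
     * ((qpochs_inf q [cpow L q lam * \<alpha>1 * \<alpha>2 / (\<beta>1 * \<beta>2), cpow L q (- lam + 1)]
         * qtheta q (\<alpha>2 * x / q))
        / (qpochs_inf q [q * \<alpha>1 * \<alpha>2 / (\<beta>1 * \<beta>2), q]
           * qtheta q (cpow L q (- lam - 1) * \<beta>1 * \<beta>2 * x / \<alpha>1)))
     * cpow L x (lam - \<mu>')"

definition A11 ::
  "(complex \<Rightarrow> complex) \<Rightarrow> complex \<Rightarrow> complex \<Rightarrow> complex \<Rightarrow> complex \<Rightarrow> complex \<Rightarrow>
   complex \<Rightarrow> complex" where
  "A11 L q \<alpha>1 \<alpha>2 \<beta>1 \<beta>2 lam =
     qpochs_inf q [\<beta>1 / \<alpha>1, \<alpha>2 / \<beta>2, cpow L q (- lam) * \<beta>2 / \<alpha>1]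
     / qpochs_inf q [cpow L q lam * \<alpha>2 / \<beta>2, \<beta>2 / \<alpha>1, cpow L q (- lam) * \<beta>1 / \<alpha>1]"

definition A12 ::
  "(complex \<Rightarrow> complex) \<Rightarrow> complex \<Rightarrow> complex \<Rightarrow> complex \<Rightarrow> complex \<Rightarrow> complex \<Rightarrow>
   complex \<Rightarrow> complex \<Rightarrow> complex" where
  "A12 L q \<alpha>1 \<alpha>2 \<beta>1 \<beta>2 lam \<mu>' =
     - (cpow L \<beta>2 (- lam + \<mu>') / (1 - q))
     * (qpochs_inf q [cpow L q (- lam) * \<beta>2 / \<alpha>1, cpow L q lam * \<alpha>1 * \<alpha>2 / (\<beta>1 * \<beta>2),
                      q * \<beta>2 / \<alpha>2, \<beta>1 / \<alpha>1, \<alpha>2 / \<beta>2]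
        / qpochs_inf q [cpow L q lam * \<alpha>2 / \<beta>2, \<alpha>2 / \<beta>1, cpow L q (- lam) * \<beta>1 / \<alpha>1,
                        cpow L q (lam + 1) * \<alpha>1 / \<beta>1, q])"

text \<open>
  The factor \<open>(\<beta>2/\<beta>1)\<^bsup>\<lambda>-\<mu>'\<^esup>\<close> is the quotient of the powers of \<open>\<beta>2\<close> and \<open>\<beta>1\<close> that
  occur in the integral solutions. Writing \<open>cpow L (\<beta>2 / \<beta>1) (lam - \<mu>')\<close> instead would be wrong,
  as \<open>L (\<beta>2 / \<beta>1)\<close> and \<open>L \<beta>2 - L \<beta>1\<close> may differ by a multiple of \<open>2\<pi>\<i>\<close>.
\<close>

definition K63 ::
  "(complex \<Rightarrow> complex) \<Rightarrow> complex \<Rightarrow> complex \<Rightarrow> complex \<Rightarrow> complex \<Rightarrow> complex \<Rightarrow>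
   complex \<Rightarrow> complex \<Rightarrow> complex" where
  "K63 L q \<alpha>1 \<alpha>2 \<beta>1 \<beta>2 lam \<mu>' =
     - (cpow L \<beta>2 (lam - \<mu>') / cpow L \<beta>1 (lam - \<mu>'))
     * ((qtheta q (\<beta>1 / \<beta>2) * qtheta q (\<alpha>2 / \<beta>1) * qtheta q (cpow L q lam * \<alpha>1 / \<beta>1))
        / (qtheta q (\<beta>2 / \<beta>1) * qtheta q (\<alpha>2 / \<beta>2) * qtheta q (cpow L q lam * \<alpha>1 / \<beta>2)))"

definition S3 ::
  "(complex \<Rightarrow> complex) \<Rightarrow> complex \<Rightarrow> complex \<Rightarrow> complex \<Rightarrow> complex \<Rightarrow> complex \<Rightarrow>
   complex \<Rightarrow> complex" where
  "S3 L q \<alpha>1 \<alpha>2 \<beta>1 \<beta>2 lam =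
     - (qpochs_inf q [cpow L q lam * \<alpha>1 * \<alpha>2 / (\<beta>1 * \<beta>2), q * \<alpha>1 / \<beta>1]
        / qpochs_inf q [cpow L q (lam + 1) * \<alpha>1 / \<beta>1, \<alpha>1 * \<alpha>2 / (\<beta>1 * \<beta>2)])"

definition S4 ::
  "(complex \<Rightarrow> complex) \<Rightarrow> complex \<Rightarrow> complex \<Rightarrow> complex \<Rightarrow> complex \<Rightarrow> complex \<Rightarrow>
   complex \<Rightarrow> complex" where
  "S4 L q \<alpha>1 \<alpha>2 \<beta>1 \<beta>2 lam =
     - (qpochs_inf q [\<beta>2 / \<alpha>1, \<alpha>2 / \<beta>1]
        / qpochs_inf q [cpow L q lam * \<alpha>2 / \<beta>1, cpow L q (- lam) * \<beta>2 / \<alpha>1])"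

definition S5 ::
  "(complex \<Rightarrow> complex) \<Rightarrow> complex \<Rightarrow> complex \<Rightarrow> complex \<Rightarrow> complex \<Rightarrow> complex \<Rightarrow>
   complex \<Rightarrow> complex \<Rightarrow> complex" where
  "S5 L q \<alpha>1 \<alpha>2 \<beta>1 \<beta>2 lam x =
     - ((qpochs_inf q [cpow L q lam * \<alpha>1 * \<alpha>2 / (\<beta>1 * \<beta>2), q * \<alpha>1 / \<beta>1]
         * qtheta q (cpow L q (- lam) * \<beta>1 * x) * qtheta q (\<beta>2 * x / q))
        / (qpochs_inf q [q * \<alpha>1 * \<alpha>2 / (\<beta>1 * \<beta>2), cpow L q lam * \<alpha>1 / \<beta>1]
           * qtheta q (cpow L q (- lam - 1) * \<beta>1 * \<beta>2 * x / \<alpha>1) * qtheta q (\<alpha>1 * x)))"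


section \<open>Correction terms\<close>

definition C1 ::
  "(complex \<Rightarrow> complex) \<Rightarrow> complex \<Rightarrow> complex \<Rightarrow> complex \<Rightarrow> complex \<Rightarrow> complex \<Rightarrow>
   complex \<Rightarrow> complex \<Rightarrow> complex" where
  "C1 L q \<alpha>1 \<alpha>2 \<beta>1 \<beta>2 lam x =
     cpow L x lam
     * (qpochs_inf q [\<beta>2 / \<alpha>1, q * \<beta>2 / \<alpha>2, cpow L q lam, \<alpha>1 * \<alpha>2 * x / \<beta>1]
        / qpochs_inf q [cpow L q (lam + 1) * \<alpha>1 / \<beta>1, \<beta>1 * \<beta>2 / (\<alpha>1 * \<alpha>2), \<alpha>2 / \<beta>1,
                        cpow L q (- lam) * \<beta>2 * x])
     * phi32 (cpow L q lam * \<alpha>1 * \<alpha>2 / (\<beta>1 * \<beta>2)) (q * \<alpha>1 / \<beta>1) (\<alpha>2 / \<beta>1)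
         (\<alpha>1 * \<alpha>2 * x / \<beta>1) (q * \<alpha>1 * \<alpha>2 / (\<beta>1 * \<beta>2)) q q"

text \<open>
  The prefactor below comes from the nonterminating three-term relation for \<open>\<^sub>3\<phi>\<^sub>2\<close>
  (Gasper and Rahman, Basic Hypergeometric Series, (III.34)); in particular \<open>\<beta>2 / \<alpha>1\<close> and
  \<open>\<alpha>2 / \<beta>1\<close> do not occur in its denominator.
\<close>

definition C2 ::
  "(complex \<Rightarrow> complex) \<Rightarrow> complex \<Rightarrow> complex \<Rightarrow> complex \<Rightarrow> complex \<Rightarrow> complex \<Rightarrow>
   complex \<Rightarrow> complex \<Rightarrow> complex" where
  "C2 L q \<alpha>1 \<alpha>2 \<beta>1 \<beta>2 lam x =
     cpow L x lam
     * (qpochs_inf q [\<alpha>1 * x, cpow L q lam * \<alpha>1 * \<alpha>2 / (\<beta>1 * \<beta>2), cpow L q lam, q * \<beta>2 / \<beta>1]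
        / qpochs_inf q [cpow L q (lam + 1) * \<alpha>1 / \<beta>1, cpow L q lam * \<alpha>2 / \<beta>1,
                        cpow L q lam * \<alpha>1 / \<beta>2, cpow L q (- lam) * \<beta>2 * x])
     * phi32 (\<beta>2 / \<alpha>1) (\<alpha>2 / \<beta>1) (cpow L q (- lam) * \<beta>2 * x)
         (q * \<beta>2 / \<beta>1) (cpow L q (- lam + 1) * \<beta>2 / \<alpha>1) q q"

definition C3 ::
  "(complex \<Rightarrow> complex) \<Rightarrow> complex \<Rightarrow> complex \<Rightarrow> complex \<Rightarrow> complex \<Rightarrow> complex \<Rightarrow>
   complex \<Rightarrow> complex \<Rightarrow> complex" where
  "C3 L q \<alpha>1 \<alpha>2 \<beta>1 \<beta>2 lam x =
     cpow L x lam
     * (qpochs_inf q [\<alpha>2 * x / q, cpow L q (- lam + 1), \<alpha>2 / \<beta>2]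
        / qpochs_inf q [cpow L q (- lam - 1) * \<beta>1 * \<beta>2 * x / \<alpha>1, q * \<alpha>1 * \<alpha>2 / (\<beta>1 * \<beta>2),
                        cpow L q (- lam) * \<beta>1 / \<alpha>1])
     * phi32 (cpow L q (lam + 1) / (\<beta>1 * x)) (cpow L q lam * \<alpha>1 * \<alpha>2 / (\<beta>1 * \<beta>2)) (q * \<alpha>1 / \<beta>1)
         (cpow L q (lam + 2) * \<alpha>1 / (\<beta>1 * \<beta>2 * x)) (cpow L q (lam + 1) * \<alpha>1 / \<beta>1) q q"


section \<open>Nonvanishing of denominators\<close>

text \<open>
  \<open>(a; q)\<^sub>\<infinity> \<noteq> 0\<close> iff \<open>(a; q)\<^sub>n \<noteq> 0\<close> for all \<open>n\<close>, so that \<open>pole_free\<close> is also the right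
  condition on the lower parameters of \<open>phi32\<close>.
\<close>

definition pole_free :: "complex \<Rightarrow> complex list \<Rightarrow> bool" where
  "pole_free q as \<longleftrightarrow> (\<forall>a\<in>set as. qpoch_inf q a \<noteq> 0)"

end

theory Submission
  imports Defs
begin

text \<open>
  All three relations are readings of one identity, the nonterminating three-term relation
  (Gasper and Rahman, Basic Hypergeometric Series, (III.34)) that writes a series
  \<open>\<^sub>3\<phi>\<^sub>2(a, b, c; d, e; q, de/(abc))\<close> as a combination of two series of argument \<open>q\<close>; here it is
  \<open>nonterminating_phi32_three_term\<close>.

  Write \<open>(a)\<close> for \<open>(a; q)\<^sub>\<infinity>\<close>, put \<open>u = e/(bc)\<close>, and consider the Jackson integral over \<open>[u, 1]\<close>, that
  is the difference of the sums over the nodes \<open>q\<^sup>m\<close> and \<open>u q\<^sup>m\<close>, of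
  \<open>(qt) (qt/u) (dt) / ((bt) (ct) (dt/a))\<close>. Its two halves are, up to infinite products, the two
  series of argument \<open>q\<close>. On the other hand the q-Gauss sum expands \<open>(dt)/(dt/a)\<close> into the Newton
  polynomials \<open>(t - 1) (t - q) \<dots> (t - q\<^bsup>n-1\<^esup>)\<close> (\<open>gauss_sum_power\<close> and \<open>gauss_sum_eq\<close>), and
  each Newton polynomial can be integrated in closed form against \<open>(qt) (qt/u) / ((bt) (ct))\<close>
  (\<open>newton_moment_eval\<close>): it vanishes at the nodes \<open>1, q, \<dots>, q\<^bsup>n-1\<^esup>\<close>, so that multiplying by it
  moves the upper end point from \<open>1\<close> to \<open>q\<^sup>n\<close>, and what remains is an Andrews--Askey integral
  (\<open>andrews_askey_eval\<close>). Integrating the expansion term by term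
  (\<open>gauss_moment_expansion\<close>) produces the series of argument \<open>de/(abc)\<close>.

  In the relation for \<open>f37\<close> the products \<open>(bu)\<close> and \<open>(cu)\<close> are \<open>(q\<^sup>\<lambda>)\<close> and \<open>(\<alpha>1 x)\<close>, which may
  vanish; the integrand then has a pole at a node. For this reason the integral is multiplied
  throughout by \<open>(b) (c) (bu) (cu)\<close>, after which every quotient such as \<open>(b)/(b q\<^sup>m)\<close> is the finite
  product \<open>(b; q)\<^sub>m\<close> and no division by \<open>(bt) (ct)\<close> is left.

  The relations for \<open>f37\<close> and \<open>f36\<close> are instances of the three-term relation. So is the one for \<open>f34\<close>,
  because the coefficient of \<open>y\<^bsub>\<beta>1\<^esub>\<close> in it is zero: by \<open>\<vartheta>\<^sub>q(t) = - t \<vartheta>\<^sub>q(1/t)\<close> the theta quotient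
  in \<open>A\<^sub>1\<^sub>,\<^sub>2 K\<^sub>6\<^sub>,\<^sub>3\<close> collapses, and that product is the negative of the other summand
  (\<open>connection_coefficient_vanishes\<close>).
\<close>

section \<open>The q-shifted factorial\<close>

lemma qpoch_0 [simp]: "qpoch q a 0 = 1"
  by (simp add: qpoch_def)

lemma qpoch_Suc: "qpoch q a (Suc n) = qpoch q a n * (1 - q ^ n * a)"
  by (simp add: qpoch_def)

lemma qpoch_add: "qpoch q a (m + n) = qpoch q a m * qpoch q (q ^ m * a) n"
  by (induction n) (simp_all add: qpoch_Suc power_add mult_ac)

lemma qpoch_Suc_shift: "qpoch q a (Suc n) = (1 - a) * qpoch q (q * a) n"
  using qpoch_add[of q a 1 n] by (simp add: qpoch_Suc)

lemma qpoch_zero [simp]: "qpoch q 0 n = 1"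
  by (simp add: qpoch_def)

locale q_series =
  fixes q :: complex
  assumes q0: "q \<noteq> 0" and q1: "norm q < 1"
begin

lemma summable_norm_power: "summable (\<lambda>n. norm q ^ n)"
  using q1 by (simp add: summable_geometric)

lemma qpoch_factors_convergent: "convergent_prod (\<lambda>j. 1 - q ^ j * a)"
proof (rule abs_convergent_prod_imp_convergent_prod)
  have "summable (\<lambda>j. norm q ^ j * norm a)"
    by (intro summable_mult2 summable_norm_power)
  then show "abs_convergent_prod (\<lambda>j. 1 - q ^ j * a)"
    by (simp add: abs_convergent_prod_conv_summable norm_mult norm_power)
qed

lemma qpoch_tendsto: "qpoch q a \<longlonglongrightarrow> qpoch_inf q a"
proof -
  have "(\<lambda>n. qpoch q a (Suc n)) \<longlonglongrightarrow> qpoch_inf q a"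
    using convergent_prod_LIMSEQ[OF qpoch_factors_convergent[of a]]
    by (simp add: qpoch_def qpoch_inf_def lessThan_Suc_atMost)
  then show ?thesis by (simp only: filterlim_sequentially_Suc)
qed

lemma qpoch_inf_zero [simp]: "qpoch_inf q 0 = 1"
proof -
  have "qpoch q 0 = (\<lambda>_. 1)" by (simp add: fun_eq_iff)
  then show ?thesis using qpoch_tendsto[of 0] LIMSEQ_unique[OF tendsto_const] by metis
qed

lemma qpoch_inf_split: "qpoch_inf q a = qpoch q a n * qpoch_inf q (q ^ n * a)"
proof (rule LIMSEQ_unique)
  show "(\<lambda>m. qpoch q a (n + m)) \<longlonglongrightarrow> qpoch_inf q a"
    using LIMSEQ_ignore_initial_segment[OF qpoch_tendsto[of a], of n] by (simp add: add.commute)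
  show "(\<lambda>m. qpoch q a (n + m)) \<longlonglongrightarrow> qpoch q a n * qpoch_inf q (q ^ n * a)"
    unfolding qpoch_add by (intro tendsto_mult_left qpoch_tendsto)
qed

lemma qpoch_inf_step: "qpoch_inf q a = (1 - a) * qpoch_inf q (q * a)"
  using qpoch_inf_split[of a 1] by (simp add: qpoch_Suc)

lemma qpoch_inf_one [simp]: "qpoch_inf q 1 = 0"
  using qpoch_inf_step[of 1] by simp

lemma qpoch_nonzero: "qpoch_inf q a \<noteq> 0 \<Longrightarrow> qpoch q a n \<noteq> 0"
  using qpoch_inf_split[of a n] by auto

lemma qpoch_inf_nonzero:
  assumes "norm a < 1"
  shows "qpoch_inf q a \<noteq> 0"
  unfolding qpoch_inf_def
proof (rule prodinf_nonzero[OF qpoch_factors_convergent])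
  fix j
  have "norm (q ^ j * a) < 1"
    using assms q1
    by (metis mult_le_cancel_right2 norm_ge_zero norm_mult norm_power order_le_less_trans
        power_le_one less_le not_less)
  then show "1 - q ^ j * a \<noteq> 0" by auto
qed

lemma qpoch_inf_q_nonzero [simp]: "qpoch_inf q q \<noteq> 0"
  using qpoch_inf_nonzero q1 by blast

lemma qpoch_q_nonzero [simp]: "qpoch q q n \<noteq> 0"
  by (simp add: qpoch_nonzero)

lemma sum_norm_power_le: "(\<Sum>j<n. norm q ^ j) \<le> 1 / (1 - norm q)"
  using sum_le_suminf[OF summable_norm_power, of "{..<n}"] q1 by (simp add: suminf_geometric)

lemma prod_one_plus_le_exp:
  assumes "0 \<le> r"
  shows "(\<Prod>j<n. 1 + norm q ^ j * r) \<le> exp (r / (1 - norm q))"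
proof -
  have "(\<Prod>j<n. 1 + norm q ^ j * r) \<le> exp (\<Sum>j<n. norm q ^ j * r)"
    using assms by (intro prod_le_exp_sum) simp
  also have "\<dots> \<le> exp (1 / (1 - norm q) * r)"
    using mult_right_mono[OF sum_norm_power_le[of n] assms] by (simp add: sum_distrib_right)
  finally show ?thesis by simp
qed

lemma norm_qpoch_le:
  assumes "norm a \<le> r"
  shows "norm (qpoch q a n) \<le> exp (r / (1 - norm q))"
proof -
  have r: "0 \<le> r" using assms norm_ge_zero order_trans by blast
  have "norm (qpoch q a n) = (\<Prod>j<n. norm (1 - q ^ j * a))"
    by (simp add: qpoch_def prod_norm)
  also have "\<dots> \<le> (\<Prod>j<n. 1 + norm q ^ j * r)"
  proof (rule prod_mono, safe)
    fix j
    have "norm (1 - q ^ j * a) \<le> 1 + norm q ^ j * norm a"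
      using norm_triangle_ineq4[of 1 "q ^ j * a"] by (simp add: norm_mult norm_power)
    also have "\<dots> \<le> 1 + norm q ^ j * r" using assms by (simp add: mult_left_mono)
    finally show "norm (1 - q ^ j * a) \<le> 1 + norm q ^ j * r" .
  qed simp
  also have "\<dots> \<le> exp (r / (1 - norm q))" by (rule prod_one_plus_le_exp[OF r])
  finally show ?thesis .
qed

lemma norm_qpoch_inf_le:
  assumes "norm a \<le> r"
  shows "norm (qpoch_inf q a) \<le> exp (r / (1 - norm q))"
  by (rule LIMSEQ_le_const2[OF tendsto_norm[OF qpoch_tendsto]])
     (use norm_qpoch_le[OF assms] in blast)

lemma norm_power_mult_le: "norm (q ^ n * a) \<le> norm a"
  using q1 by (simp add: norm_mult norm_power power_le_one mult_left_le_one_le)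

lemma power_mult_tendsto_zero: "(\<lambda>n. q ^ n * a) \<longlonglongrightarrow> 0"
  using q1 by (intro tendsto_mult_left_zero LIMSEQ_power_zero) simp

lemma power_in_disc:
  obtains M where "norm (d * q ^ M / a) < 1"
proof -
  have "(\<lambda>m. norm (d * q ^ m / a)) \<longlonglongrightarrow> 0"
    using tendsto_norm[OF power_mult_tendsto_zero[of "d / a"]] by (simp add: mult_ac)
  then have "\<forall>\<^sub>F m in sequentially. norm (d * q ^ m / a) < 1"
    by (rule order_tendstoD) simp
  then show ?thesis
    using that by (auto simp: eventually_sequentially)
qed

lemma continuous_on_qpoch: "continuous_on A (\<lambda>a. qpoch q a n)"
  unfolding qpoch_def by (intro continuous_intros)

text \<open>
  The partial products converge uniformly on every disc by the Weierstrass test.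
\<close>
lemma isCont_qpoch_inf: "isCont (qpoch_inf q) a"
proof -
  define A where "A = cball (0 :: complex) (norm a + 1)"
  have "uniformly_convergent_on A (\<lambda>N x. \<Sum>n<N. norm ((1 - q ^ n * x) - 1))"
  proof (rule Weierstrass_m_test')
    show "norm (norm ((1 - q ^ n * x) - 1)) \<le> norm q ^ n * (norm a + 1)" if "x \<in> A" for n x
      using that by (simp add: A_def norm_mult norm_power mult_left_mono)
    show "summable (\<lambda>n. norm q ^ n * (norm a + 1))"
      by (intro summable_mult2 summable_norm_power)
  qed
  then have "uniformly_convergent_on A (\<lambda>N x. \<Prod>n<N. 1 - q ^ n * x)"
    by (intro uniformly_convergent_on_prod' continuous_intros) (auto simp: A_def)
  then have "uniformly_convergent_on A (\<lambda>N x. qpoch q x N)"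
    by (simp add: qpoch_def)
  then obtain l where l: "uniform_limit A (\<lambda>N x. qpoch q x N) l sequentially"
    by (auto simp: uniformly_convergent_on_def)
  have "l x = qpoch_inf q x" if "x \<in> A" for x
    using LIMSEQ_unique[OF tendsto_uniform_limitI[OF l that] qpoch_tendsto] .
  moreover have "continuous_on A l"
    by (rule uniform_limit_theorem[OF _ l]) (simp_all add: continuous_on_qpoch)
  ultimately have "continuous_on A (qpoch_inf q)"
    by (simp add: continuous_on_eq)
  then have "continuous_on (ball 0 (norm a + 1)) (qpoch_inf q)"
    by (rule continuous_on_subset) (auto simp: A_def)
  then show ?thesis
    by (simp add: continuous_on_eq_continuous_at)
qed

lemma tendsto_qpoch_inf [tendsto_intros]:
  "(f \<longlongrightarrow> a) F \<Longrightarrow> ((\<lambda>x. qpoch_inf q (f x)) \<longlongrightarrow> qpoch_inf q a) F"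
  by (rule isCont_tendsto_compose[OF isCont_qpoch_inf])

lemma qpoch_inf_power_tendsto: "(\<lambda>k. qpoch_inf q (q ^ k * a)) \<longlonglongrightarrow> 1"
  using tendsto_qpoch_inf[OF power_mult_tendsto_zero[of a]] by simp

end

section \<open>The q-Gauss sum as a Newton series\<close>

text \<open>
  Tannery's theorem for the case that the majorant holds for all summation indices at once.
\<close>
lemma tannery:
  fixes a :: "nat \<Rightarrow> 'b \<Rightarrow> complex"
  assumes "\<And>k. ((\<lambda>x. a k x) \<longlongrightarrow> b k) F"
    and "\<forall>\<^sub>F x in F. \<forall>k. norm (a k x) \<le> M k"
    and "summable M" and "F \<noteq> bot"
  shows "((\<lambda>x. \<Sum>k. a k x) \<longlongrightarrow> (\<Sum>k. b k)) F"
proof -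
  have "\<forall>\<^sub>F (k, x) in (at_top :: nat filter) \<times>\<^sub>F F. \<forall>k. norm (a k x) \<le> M k"
    using assms(2) by (subst eventually_prod2) simp_all
  then have "\<forall>\<^sub>F (k, x) in at_top \<times>\<^sub>F F. norm (a k x) \<le> M k"
    by (rule eventually_mono) auto
  then show ?thesis
    using tannerys_theorem[of a b F M, OF assms(1) _ assms(3,4)] by blast
qed

definition newton :: "complex \<Rightarrow> nat \<Rightarrow> complex \<Rightarrow> complex" where
  "newton q n t = (\<Prod>i<n. t - q ^ i)"

text \<open>
  As \<open>t\<^sup>n (1/t; q)\<^sub>n\<close> is the Newton polynomial of degree \<open>n\<close> at \<open>t\<close>, these are the terms of
  \<open>\<^sub>2\<phi>\<^sub>1(a, 1/t; d; q, dt/a)\<close>. The polynomial form also makes sense at \<open>t = 0\<close>.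
\<close>
definition gauss_term :: "complex \<Rightarrow> complex \<Rightarrow> complex \<Rightarrow> complex \<Rightarrow> nat \<Rightarrow> complex" where
  "gauss_term q a d t n =
     qpoch q a n / (qpoch q q n * qpoch q d n) * (d / a) ^ n * newton q n t"

context q_series
begin

lemma newton_Suc: "newton q (Suc n) t = newton q n t * (t - q ^ n)"
  by (simp add: newton_def)

lemma newton_0 [simp]: "newton q 0 t = 1"
  by (simp add: newton_def)

text \<open>
  The factors of \<open>newton q (Suc n) (q * t)\<close> are \<open>q t - 1\<close> and \<open>q\<close> times those of
  \<open>newton q n t\<close>.
\<close>
lemma newton_shift: "newton q (Suc n) (q * t) = q ^ n * (q * t - 1) * newton q n t"
proof (induction n)
  case (Suc n)
  have "newton q (Suc (Suc n)) (q * t) = newton q (Suc n) (q * t) * (q * (t - q ^ n))"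
    by (subst newton_Suc) (simp add: algebra_simps)
  then show ?case
    unfolding Suc.IH by (simp add: newton_Suc[of n t])
qed (simp add: newton_Suc)

lemma newton_eq_0: "m < n \<Longrightarrow> newton q n (q ^ m) = 0"
  by (auto simp: newton_def)

text \<open>
  A telescoping certificate for the q-difference equation of the q-Gauss sum: the terms on both
  sides differ by the increment of the multiple of \<open>gauss_term q a d t N\<close> on the left, which is
  the boundary term after summation.
\<close>
lemma gauss_partial_sum_step:
  assumes a: "a \<noteq> 0" and d: "qpoch_inf q d \<noteq> 0"
  shows "(1 - d * t / a) * (\<Sum>n\<le>N. gauss_term q a d t n)
           + d * t / a * (1 - a * q ^ N) * gauss_term q a d t N
         = (1 - d * t) * (\<Sum>n\<le>N. gauss_term q a d (q * t) n)"
proof (induction N)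
  case 0
  show ?case using a by (simp add: gauss_term_def field_simps)
next
  case (Suc N)
  let ?Z = "qpoch q a N * (d / a) ^ N * newton q N t / (qpoch q q (Suc N) * qpoch q d (Suc N))"
  have nz: "qpoch q q (Suc N) \<noteq> 0" "qpoch q d (Suc N) \<noteq> 0"
    using qpoch_nonzero[OF d] by (auto simp del: qpoch_Suc)
  then have nz': "1 - q ^ N * q \<noteq> 0" "1 - q ^ N * d \<noteq> 0" "qpoch q d N \<noteq> 0"
    by (auto simp: qpoch_Suc)
  have e1: "gauss_term q a d t N = ?Z * (1 - q ^ N * q) * (1 - q ^ N * d)"
    using nz' by (simp add: gauss_term_def qpoch_Suc divide_simps)
  have e2: "gauss_term q a d t (Suc N) = ?Z * (1 - q ^ N * a) * (d / a) * (t - q ^ N)"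
    by (simp add: gauss_term_def qpoch_Suc newton_Suc)
  have e3: "gauss_term q a d (q * t) (Suc N) = ?Z * (1 - q ^ N * a) * (d / a) * (q ^ N * (q * t - 1))"
    by (simp add: gauss_term_def qpoch_Suc newton_shift)
  have step: "(1 - d * t / a) * gauss_term q a d t (Suc N)
           + d * t / a * (1 - a * q ^ Suc N) * gauss_term q a d t (Suc N)
           - d * t / a * (1 - a * q ^ N) * gauss_term q a d t N
        = (1 - d * t) * gauss_term q a d (q * t) (Suc N)"
    unfolding e1 e2 e3 using a by (simp add: divide_simps) (simp add: algebra_simps)
  have "(1 - d * t / a) * (\<Sum>n\<le>Suc N. gauss_term q a d t n)
           + d * t / a * (1 - a * q ^ Suc N) * gauss_term q a d t (Suc N)
      = ((1 - d * t / a) * (\<Sum>n\<le>N. gauss_term q a d t n)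
           + d * t / a * (1 - a * q ^ N) * gauss_term q a d t N)
        + ((1 - d * t / a) * gauss_term q a d t (Suc N)
           + d * t / a * (1 - a * q ^ Suc N) * gauss_term q a d t (Suc N)
           - d * t / a * (1 - a * q ^ N) * gauss_term q a d t N)"
    by (simp only: sum.atMost_Suc) (simp add: ring_distribs)
  then show ?case
    unfolding Suc.IH step by (simp only: sum.atMost_Suc distrib_left)
qed

lemma qpoch_ratio_bounded:
  assumes "qpoch_inf q d \<noteq> 0"
  obtains C where "C > 0" "\<And>n. norm (qpoch q a n / (qpoch q q n * qpoch q d n)) \<le> C"
proof -
  have "(\<lambda>n. qpoch q a n / (qpoch q q n * qpoch q d n))
          \<longlonglongrightarrow> qpoch_inf q a / (qpoch_inf q q * qpoch_inf q d)"
    by (intro tendsto_intros qpoch_tendsto) (use assms in auto)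
  then have "Bseq (\<lambda>n. qpoch q a n / (qpoch q q n * qpoch q d n))"
    by (intro convergent_imp_Bseq) (auto simp: convergent_def)
  then show ?thesis using that by (auto elim: BseqE)
qed

text \<open>
  Pulling \<open>r\<close> out of each of the \<open>n\<close> factors leaves a product that is bounded independently of
  \<open>n\<close>; this is what makes the expansion converge geometrically for \<open>norm (d * t / a) < 1\<close>.
\<close>
lemma norm_newton_le:
  assumes "norm t \<le> r" "0 < r"
  shows "norm (newton q n t) \<le> r ^ n * exp ((1 / r) / (1 - norm q))"
proof -
  have "norm (newton q n t) = (\<Prod>i<n. norm (t - q ^ i))"
    by (simp add: newton_def prod_norm)
  also have "\<dots> \<le> (\<Prod>i<n. r * (1 + norm q ^ i * (1 / r)))"
  proof (rule prod_mono, safe)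
    fix i
    have "norm (t - q ^ i) \<le> norm t + norm q ^ i"
      using norm_triangle_ineq4[of t "q ^ i"] by (simp add: norm_power)
    then show "norm (t - q ^ i) \<le> r * (1 + norm q ^ i * (1 / r))"
      using assms by (simp add: ring_distribs)
  qed simp
  also have "\<dots> = r ^ n * (\<Prod>i<n. 1 + norm q ^ i * (1 / r))"
    by (simp add: prod.distrib)
  also have "\<dots> \<le> r ^ n * exp ((1 / r) / (1 - norm q))"
    using assms by (intro mult_left_mono prod_one_plus_le_exp) auto
  finally show ?thesis .
qed

lemma norm_gauss_term_le:
  assumes "qpoch_inf q d \<noteq> 0" "0 < r"
  obtains C where "C > 0"
    "\<And>n (t :: complex). norm t \<le> r \<Longrightarrow> norm (gauss_term q a d t n) \<le> C * (norm (d / a) * r) ^ n"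
proof -
  obtain C where C: "C > 0" "\<And>n. norm (qpoch q a n / (qpoch q q n * qpoch q d n)) \<le> C"
    using qpoch_ratio_bounded[OF assms(1)] by blast
  show ?thesis
  proof
    show "C * exp ((1 / r) / (1 - norm q)) > 0" using C by simp
    fix n and t :: complex assume t: "norm t \<le> r"
    have "norm (gauss_term q a d t n)
        = norm (qpoch q a n / (qpoch q q n * qpoch q d n)) * norm (d / a) ^ n * norm (newton q n t)"
      by (simp only: gauss_term_def norm_mult norm_power)
    also have "\<dots> \<le> C * norm (d / a) ^ n * (r ^ n * exp ((1 / r) / (1 - norm q)))"
      using C norm_newton_le[OF t assms(2), of n] by (intro mult_mono) auto
    finally show "norm (gauss_term q a d t n)
        \<le> C * exp ((1 / r) / (1 - norm q)) * (norm (d / a) * r) ^ n"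
      by (simp add: power_mult_distrib mult_ac)
  qed
qed

abbreviation gauss_sum :: "complex \<Rightarrow> complex \<Rightarrow> complex \<Rightarrow> complex" where
  "gauss_sum a d t \<equiv> (\<Sum>n. gauss_term q a d t n)"

context
  fixes a d :: complex
  assumes a: "a \<noteq> 0" and d: "qpoch_inf q d \<noteq> 0"
begin

text \<open>
  The bound on Newton polynomials needs a positive radius, also for \<open>t = 0\<close>.
\<close>
lemma radius_between:
  assumes "norm (d * t / a) < 1"
  obtains r where "0 < r" "norm t \<le> r" "norm (d / a) * r < 1"
proof (cases "t = 0")
  case True
  show ?thesis
    by (rule that[of "1 / (1 + norm (d / a))"])
       (use True in \<open>simp_all add: add_pos_nonneg\<close>)
next
  case False
  then show ?thesis
    using assms by (intro that[of "norm t"]) (auto simp: norm_mult norm_divide mult_ac)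
qed

lemma gauss_term_geometric_bound:
  assumes "norm (d * t / a) < 1"
  obtains C \<rho> where "0 \<le> \<rho>" "\<rho> < 1" "0 < C"
    "\<And>n s. norm s \<le> norm t \<Longrightarrow> norm (gauss_term q a d s n) \<le> C * \<rho> ^ n"
proof -
  obtain r where r: "0 < r" "norm t \<le> r" "norm (d / a) * r < 1"
    using radius_between[OF assms] .
  obtain C where C: "C > 0"
    "\<And>n (s :: complex). norm s \<le> r \<Longrightarrow> norm (gauss_term q a d s n) \<le> C * (norm (d / a) * r) ^ n"
    using norm_gauss_term_le[OF d r(1)] by metis
  show ?thesis
    by (rule that[of "norm (d / a) * r" C]) (use r C in auto)
qed

lemma gauss_term_summable:
  assumes "norm (d * t / a) < 1"
  shows "summable (gauss_term q a d t)"
proof -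
  obtain C \<rho> where "0 \<le> \<rho>" "\<rho> < 1" "0 < C"
    and b: "\<And>n s. norm s \<le> norm t \<Longrightarrow> norm (gauss_term q a d s n) \<le> C * \<rho> ^ n"
    using gauss_term_geometric_bound[OF assms] by metis
  then have "summable (\<lambda>n. C * \<rho> ^ n)" by (intro summable_mult summable_geometric) auto
  then show ?thesis
    by (rule summable_comparison_test[rotated]) (use b in blast)
qed

lemma gauss_term_power_eq_0: "m < n \<Longrightarrow> gauss_term q a d (q ^ m) n = 0"
  by (simp add: gauss_term_def newton_eq_0)

lemma gauss_term_power_summable: "summable (gauss_term q a d (q ^ m))"
  by (rule summable_finite[of "{..m}"]) (use gauss_term_power_eq_0 in auto)

text \<open>
  Summability is assumed at \<open>t\<close> and \<open>q * t\<close> only. So the equation holds in the disc of convergence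
  and also at the nodes \<open>t = q\<^sup>m\<close>, where the series terminates, even when they lie outside the disc.
\<close>
lemma gauss_sum_step:
  assumes "summable (gauss_term q a d t)" "summable (gauss_term q a d (q * t))"
  shows "(1 - d * t / a) * gauss_sum a d t = (1 - d * t) * gauss_sum a d (q * t)"
proof (rule LIMSEQ_unique)
  show "(\<lambda>N. (1 - d * t) * (\<Sum>n\<le>N. gauss_term q a d (q * t) n))
          \<longlonglongrightarrow> (1 - d * t) * gauss_sum a d (q * t)"
    by (intro tendsto_intros summable_LIMSEQ' assms)
  have "(\<lambda>N. (1 - d * t / a) * (\<Sum>n\<le>N. gauss_term q a d t n)
           + d * t / a * (1 - a * q ^ N) * gauss_term q a d t N)
         \<longlonglongrightarrow> (1 - d * t / a) * gauss_sum a d t + d * t / a * (1 - a * 0) * 0"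
    using q1 a by (intro tendsto_intros summable_LIMSEQ' summable_LIMSEQ_zero assms LIMSEQ_power_zero) simp_all
  then show "(\<lambda>N. (1 - d * t) * (\<Sum>n\<le>N. gauss_term q a d (q * t) n))
         \<longlonglongrightarrow> (1 - d * t / a) * gauss_sum a d t"
    unfolding gauss_partial_sum_step[OF a d] by simp
qed

lemma gauss_sum_tendsto_zero:
  assumes "norm (d * t / a) < 1"
  shows "(\<lambda>m. gauss_sum a d (q ^ m * t)) \<longlonglongrightarrow> gauss_sum a d 0"
proof -
  obtain C \<rho> where \<rho>: "0 \<le> \<rho>" "\<rho> < 1" "0 < C"
    and b: "\<And>n s. norm s \<le> norm t \<Longrightarrow> norm (gauss_term q a d s n) \<le> C * \<rho> ^ n"
    using gauss_term_geometric_bound[OF assms] by metis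
  show ?thesis
  proof (rule tannery)
    show "(\<lambda>m. gauss_term q a d (q ^ m * t) n) \<longlonglongrightarrow> gauss_term q a d 0 n" for n
      unfolding gauss_term_def newton_def
      by (intro tendsto_mult_left tendsto_prod tendsto_diff tendsto_const power_mult_tendsto_zero)
    show "\<forall>\<^sub>F m in sequentially. \<forall>n. norm (gauss_term q a d (q ^ m * t) n) \<le> C * \<rho> ^ n"
      using b norm_power_mult_le by (intro always_eventually) blast
    show "summable (\<lambda>n. C * \<rho> ^ n)"
      using \<rho> by (intro summable_mult summable_geometric) auto
  qed simp
qed

lemma gauss_sum_iterate:
  assumes "norm (d * t / a) < 1"
  shows "gauss_sum a d t * qpoch q (d * t / a) M = qpoch q (d * t) M * gauss_sum a d (q ^ M * t)"
proof (induction M)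
  case (Suc M)
  have n: "norm (d * (q ^ k * t) / a) < 1" for k
    using norm_power_mult_le[of k "d * t / a"] assms by (simp add: mult_ac)
  have "(1 - d * (q ^ M * t) / a) * gauss_sum a d (q ^ M * t)
      = (1 - d * (q ^ M * t)) * gauss_sum a d (q ^ Suc M * t)"
    using gauss_sum_step[OF gauss_term_summable[OF n[of M]]] gauss_term_summable[OF n[of "Suc M"]]
    by (simp add: mult_ac)
  then have step: "(1 - q ^ M * (d * t / a)) * gauss_sum a d (q ^ M * t)
      = (1 - q ^ M * (d * t)) * gauss_sum a d (q ^ Suc M * t)"
    by (simp add: mult_ac)
  have "gauss_sum a d t * qpoch q (d * t / a) (Suc M)
      = qpoch q (d * t) M * ((1 - q ^ M * (d * t / a)) * gauss_sum a d (q ^ M * t))"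
    unfolding qpoch_Suc mult.assoc[symmetric] Suc.IH by (simp only: mult_ac)
  then show ?case unfolding step by (simp only: qpoch_Suc mult.assoc)
qed simp

text \<open>
  The series is \<open>1\<close> at \<open>t = 1\<close>, and the q-difference equation leads from \<open>q\<^sup>m\<close> to \<open>q\<^bsup>m+1\<^esup>\<close>.
  The step divides by \<open>1 - d * q ^ m\<close> only: \<open>1 - d * q ^ m / a\<close> does vanish in the application to
  \<open>f34\<close>, where \<open>d / a = q\<^sup>\<lambda>\<close>, if \<open>q\<^sup>\<lambda> = q\<^bsup>-m\<^esup>\<close>.
\<close>
lemma gauss_sum_power: "gauss_sum a d (q ^ m) = qpoch q (d / a) m / qpoch q d m"
proof (induction m)
  case 0
  have "gauss_sum a d (q ^ 0) = (\<Sum>n\<in>{0}. gauss_term q a d (q ^ 0) n)"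
    by (rule suminf_finite) (use gauss_term_power_eq_0[of 0] in auto)
  then show ?case by (simp add: gauss_term_def)
next
  case (Suc m)
  have "(1 - d * q ^ m / a) * gauss_sum a d (q ^ m) = (1 - d * q ^ m) * gauss_sum a d (q ^ Suc m)"
    using gauss_sum_step[OF gauss_term_power_summable[of m]] gauss_term_power_summable[of "Suc m"]
    by simp
  moreover have "qpoch q d (Suc m) \<noteq> 0" by (rule qpoch_nonzero[OF d])
  ultimately show ?case
    unfolding Suc.IH by (simp add: qpoch_Suc field_simps)
qed

text \<open>
  The value at \<open>0\<close> is the limit of the known values at the nodes \<open>q\<^sup>m\<close>. It is the constant of
  integration that the q-difference equation leaves open.
\<close>
lemma gauss_sum_zero: "gauss_sum a d 0 = qpoch_inf q (d / a) / qpoch_inf q d"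
proof -
  obtain M where M: "norm (d * q ^ M / a) < 1"
    using power_in_disc[of d a] .
  show ?thesis
  proof (rule LIMSEQ_unique)
    show "(\<lambda>m. gauss_sum a d (q ^ (m + M))) \<longlonglongrightarrow> gauss_sum a d 0"
      using gauss_sum_tendsto_zero[OF M] by (simp add: power_add)
    have "(\<lambda>m. gauss_sum a d (q ^ m)) \<longlonglongrightarrow> qpoch_inf q (d / a) / qpoch_inf q d"
      unfolding gauss_sum_power by (intro tendsto_intros qpoch_tendsto d)
    then show "(\<lambda>m. gauss_sum a d (q ^ (m + M))) \<longlonglongrightarrow> qpoch_inf q (d / a) / qpoch_inf q d"
      by (rule LIMSEQ_ignore_initial_segment)
  qed
qed

text \<open>
  The q-Gauss sum: iterating the q-difference equation moves the argument to \<open>0\<close>.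
\<close>
lemma gauss_sum_eq:
  assumes "norm (d * t / a) < 1"
  shows "gauss_sum a d t
    = qpoch_inf q (d / a) * qpoch_inf q (d * t) / (qpoch_inf q d * qpoch_inf q (d * t / a))"
proof -
  have "gauss_sum a d t * qpoch_inf q (d * t / a) = qpoch_inf q (d * t) * gauss_sum a d 0"
  proof (rule LIMSEQ_unique)
    show "(\<lambda>M. gauss_sum a d t * qpoch q (d * t / a) M)
        \<longlonglongrightarrow> gauss_sum a d t * qpoch_inf q (d * t / a)"
      by (intro tendsto_intros qpoch_tendsto)
    show "(\<lambda>M. gauss_sum a d t * qpoch q (d * t / a) M)
        \<longlonglongrightarrow> qpoch_inf q (d * t) * gauss_sum a d 0"
      unfolding gauss_sum_iterate[OF assms]
      by (intro tendsto_mult gauss_sum_tendsto_zero[OF assms] qpoch_tendsto)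
  qed
  moreover have "qpoch_inf q (d * t / a) \<noteq> 0" by (rule qpoch_inf_nonzero[OF assms])
  ultimately show ?thesis using d by (simp add: gauss_sum_zero field_simps)
qed

end

end

section \<open>The Andrews--Askey integral\<close>

text \<open>
  At the node \<open>t = s q\<^sup>k\<close>, with \<open>s = 1\<close> or \<open>s = u\<close>, this is the weight
  \<open>(qt, qt/u; q)\<^sub>\<infinity> / (\<alpha>t, \<beta>t; q)\<^sub>\<infinity>\<close> multiplied by \<open>(\<alpha>s, \<beta>s; q)\<^sub>\<infinity>\<close>. The multiplication
  turns the denominator into a finite product in the numerator.
\<close>
definition jackson_weight :: "complex \<Rightarrow> complex \<Rightarrow> complex \<Rightarrow> complex \<Rightarrow> complex \<Rightarrow> nat \<Rightarrow> complex" where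
  "jackson_weight q u s \<alpha> \<beta> k =
     qpoch_inf q (q ^ Suc k * s) * qpoch_inf q (q ^ Suc k * s / u)
       * qpoch q (\<alpha> * s) k * qpoch q (\<beta> * s) k"

definition jackson_sum :: "complex \<Rightarrow> complex \<Rightarrow> complex \<Rightarrow> complex \<Rightarrow> complex \<Rightarrow> complex" where
  "jackson_sum q u s \<alpha> \<beta> = (\<Sum>k. s * q ^ k * jackson_weight q u s \<alpha> \<beta> k)"

text \<open>
  The Jackson integral of the Andrews--Askey weight over \<open>[u, 1]\<close>, divided by \<open>1 - q\<close> and multiplied
  by \<open>(\<alpha>, \<beta>, \<alpha>u, \<beta>u; q)\<^sub>\<infinity>\<close>. It is entire in \<open>\<alpha>\<close> and \<open>\<beta>\<close>.
\<close>
definition andrews_askey :: "complex \<Rightarrow> complex \<Rightarrow> complex \<Rightarrow> complex \<Rightarrow> complex" where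
  "andrews_askey q u \<alpha> \<beta> =
     qpoch_inf q (\<alpha> * u) * qpoch_inf q (\<beta> * u) * jackson_sum q u 1 \<alpha> \<beta>
       - qpoch_inf q \<alpha> * qpoch_inf q \<beta> * jackson_sum q u u \<alpha> \<beta>"

context q_series
begin

lemma jackson_weight_bound:
  obtains C where "C > 0" "\<And>\<alpha> k. norm \<alpha> \<le> r \<Longrightarrow> norm (jackson_weight q u s \<alpha> \<beta> k) \<le> C"
proof -
  let ?e = "\<lambda>x. exp (x / (1 - norm q))"
  show ?thesis
  proof (rule that)
    show "?e (norm s) * ?e (norm (s / u)) * ?e (r * norm s) * ?e (norm (\<beta> * s)) > 0" by simp
    fix \<alpha> :: complex and k assume "norm \<alpha> \<le> r"
    then have "norm (\<alpha> * s) \<le> r * norm s" by (simp add: norm_mult mult_right_mono)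
    then show "norm (jackson_weight q u s \<alpha> \<beta> k)
        \<le> ?e (norm s) * ?e (norm (s / u)) * ?e (r * norm s) * ?e (norm (\<beta> * s))"
      using norm_power_mult_le[of "Suc k" s] norm_power_mult_le[of "Suc k" "s / u"]
      unfolding times_divide_eq_right
      unfolding jackson_weight_def norm_mult
      by (intro mult_mono norm_qpoch_le norm_qpoch_inf_le) (auto simp: norm_mult norm_divide)
  qed
qed

lemma jackson_term_bound:
  obtains C where "C > 0"
    "\<And>\<alpha> k. norm \<alpha> \<le> r \<Longrightarrow> norm (s * q ^ k * jackson_weight q u s \<alpha> \<beta> k) \<le> C * norm q ^ k"
proof -
  obtain C where C: "C > 0" "\<And>\<alpha> k. norm \<alpha> \<le> r \<Longrightarrow> norm (jackson_weight q u s \<alpha> \<beta> k) \<le> C"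
    using jackson_weight_bound[of r u s \<beta>] by metis
  show ?thesis
  proof (rule that)
    show "norm s * C + 1 > 0" using C by (simp add: add_nonneg_pos)
    fix \<alpha> :: complex and k assume "norm \<alpha> \<le> r"
    then have "norm (s * q ^ k * jackson_weight q u s \<alpha> \<beta> k) \<le> norm s * norm q ^ k * C"
      using C by (simp add: norm_mult norm_power mult_left_mono)
    then show "norm (s * q ^ k * jackson_weight q u s \<alpha> \<beta> k) \<le> (norm s * C + 1) * norm q ^ k"
      by (simp add: algebra_simps) (smt (verit) norm_ge_zero zero_le_power)
  qed
qed

lemma summable_const_norm_power: "summable (\<lambda>k. C * norm q ^ k)"
  by (intro summable_mult summable_norm_power)

lemma jackson_term_summable: "summable (\<lambda>k. s * q ^ k * jackson_weight q u s \<alpha> \<beta> k)"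
proof -
  obtain C where C: "C > 0"
    "\<And>\<alpha>' k. norm \<alpha>' \<le> norm \<alpha> \<Longrightarrow> norm (s * q ^ k * jackson_weight q u s \<alpha>' \<beta> k) \<le> C * norm q ^ k"
    using jackson_term_bound[of "norm \<alpha>" s u \<beta>] by metis
  show ?thesis
    by (rule summable_comparison_test[OF _ summable_const_norm_power[of C]]) (use C in blast)
qed

lemma isCont_jackson_sum: "isCont (\<lambda>\<alpha>. jackson_sum q u s \<alpha> \<beta>) \<alpha>"
proof -
  obtain C where C: "C > 0"
    "\<And>\<alpha>' k. norm \<alpha>' \<le> norm \<alpha> + 1 \<Longrightarrow> norm (s * q ^ k * jackson_weight q u s \<alpha>' \<beta> k) \<le> C * norm q ^ k"
    using jackson_term_bound[of "norm \<alpha> + 1" s u \<beta>] by metis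
  show ?thesis
    unfolding isCont_def jackson_sum_def
  proof (rule tannery)
    show "summable (\<lambda>k. C * norm q ^ k)" by (rule summable_const_norm_power)
    have "((\<lambda>\<alpha>'. norm \<alpha>') \<longlongrightarrow> norm \<alpha>) (at \<alpha>)" by (intro tendsto_intros)
    then have "\<forall>\<^sub>F \<alpha>' in at \<alpha>. norm \<alpha>' < norm \<alpha> + 1" by (rule order_tendstoD) simp
    then show "\<forall>\<^sub>F \<alpha>' in at \<alpha>. \<forall>k. norm (s * q ^ k * jackson_weight q u s \<alpha>' \<beta> k) \<le> C * norm q ^ k"
      by eventually_elim (use C in auto)
    show "((\<lambda>\<alpha>'. s * q ^ k * jackson_weight q u s \<alpha>' \<beta> k) \<longlongrightarrow> s * q ^ k * jackson_weight q u s \<alpha> \<beta> k) (at \<alpha>)" for k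
      unfolding jackson_weight_def qpoch_def by (intro tendsto_intros)
  qed simp
qed

lemma isCont_andrews_askey: "isCont (\<lambda>\<alpha>. andrews_askey q u \<alpha> \<beta>) \<alpha>"
proof -
  have "isCont (\<lambda>\<alpha>. qpoch_inf q (\<alpha> * u)) \<alpha>"
    unfolding isCont_def by (intro tendsto_qpoch_inf tendsto_intros)
  then show ?thesis
    unfolding andrews_askey_def
    by (intro continuous_intros isCont_jackson_sum isCont_qpoch_inf) 
qed

text \<open>
  With \<open>H k\<close> the function \<open>(t, t/u; q)\<^sub>\<infinity> / (\<alpha>t, \<beta>t; q)\<^sub>\<infinity>\<close> at \<open>t = s q\<^sup>k\<close>, multiplied by
  \<open>(\<alpha>s, \<beta>s; q)\<^sub>\<infinity>\<close>, the increment \<open>H k - H (k + 1)\<close> is \<open>t\<close> times the weight times a linear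
  polynomial in \<open>t\<close>. The factor \<open>1 - \<alpha>t\<close> replaces \<open>\<alpha>\<close> by \<open>q \<alpha>\<close> in the weight, so that telescoping
  relates the sums for \<open>\<alpha>\<close> and \<open>q \<alpha>\<close>. \<open>H 0\<close> is zero because \<open>s\<close> is an end point of the interval.
\<close>
lemma jackson_sum_step:
  assumes u: "u \<noteq> 0" and s: "s = 1 \<or> s = u"
  shows "(1 - \<alpha>) * (1 - \<alpha> * u) * jackson_sum q u s \<alpha> \<beta>
           - (1 - \<alpha> * \<beta> * u) * (1 - \<alpha> * s) * jackson_sum q u s (q * \<alpha>) \<beta>
         = - (\<alpha> * u * qpoch_inf q (\<alpha> * s) * qpoch_inf q (\<beta> * s))"
proof (rule sums_unique2)
  define H where "H = (\<lambda>k. qpoch_inf q (q ^ k * s) * qpoch_inf q (q ^ k * (s / u))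
                             * qpoch q (\<alpha> * s) k * qpoch q (\<beta> * s) k)"
  have diff: "\<alpha> * u * (H k - H (Suc k)) =
      (1 - \<alpha>) * (1 - \<alpha> * u) * (s * q ^ k * jackson_weight q u s \<alpha> \<beta> k)
        - (1 - \<alpha> * \<beta> * u) * (1 - \<alpha> * s) * (s * q ^ k * jackson_weight q u s (q * \<alpha>) \<beta> k)" for k
  proof -
    let ?W = "jackson_weight q u s \<alpha> \<beta> k"
    have "H k = (1 - q ^ k * s) * (1 - q ^ k * (s / u)) * ?W"
      unfolding H_def jackson_weight_def
      by (subst (1 2) qpoch_inf_step) (simp add: mult_ac)
    moreover have "H (Suc k) = (1 - q ^ k * (\<alpha> * s)) * (1 - q ^ k * (\<beta> * s)) * ?W"
      by (simp add: H_def jackson_weight_def qpoch_Suc mult_ac)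
    moreover have shift: "(1 - \<alpha> * s) * jackson_weight q u s (q * \<alpha>) \<beta> k = (1 - q ^ k * (\<alpha> * s)) * ?W"
      using qpoch_Suc_shift[of q "\<alpha> * s" k] by (simp add: jackson_weight_def qpoch_Suc mult_ac)
    have "(1 - \<alpha> * \<beta> * u) * (1 - \<alpha> * s) * (s * q ^ k * jackson_weight q u s (q * \<alpha>) \<beta> k)
       = (1 - \<alpha> * \<beta> * u) * (s * q ^ k) * ((1 - q ^ k * (\<alpha> * s)) * ?W)"
      unfolding shift[symmetric] by (simp only: mult_ac)
    ultimately show ?thesis
      using u by (simp only:) (simp add: field_simps)
  qed
  have "H \<longlonglongrightarrow> 1 * 1 * qpoch_inf q (\<alpha> * s) * qpoch_inf q (\<beta> * s)"
    unfolding H_def by (intro tendsto_mult qpoch_inf_power_tendsto qpoch_tendsto)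
  then have "(\<lambda>k. H k - H (Suc k)) sums (H 0 - qpoch_inf q (\<alpha> * s) * qpoch_inf q (\<beta> * s))"
    by (intro telescope_sums') simp
  moreover have "H 0 = 0"
    using s u by (auto simp: H_def qpoch_inf_one)
  ultimately have "(\<lambda>k. \<alpha> * u * (H k - H (Suc k))) sums
      (\<alpha> * u * (0 - qpoch_inf q (\<alpha> * s) * qpoch_inf q (\<beta> * s)))"
    by (intro sums_mult) simp
  then show "(\<lambda>k. \<alpha> * u * (H k - H (Suc k))) sums
      - (\<alpha> * u * qpoch_inf q (\<alpha> * s) * qpoch_inf q (\<beta> * s))"
    by (simp add: mult_ac)
  show "(\<lambda>k. \<alpha> * u * (H k - H (Suc k))) sums
      ((1 - \<alpha>) * (1 - \<alpha> * u) * jackson_sum q u s \<alpha> \<beta>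
           - (1 - \<alpha> * \<beta> * u) * (1 - \<alpha> * s) * jackson_sum q u s (q * \<alpha>) \<beta>)"
    unfolding diff jackson_sum_def
    by (intro sums_diff sums_mult summable_sums jackson_term_summable)
qed

text \<open>
  The boundary contributions of the two halves cancel in the integral over \<open>[u, 1]\<close>. The computation
  produces the factor \<open>(1 - \<alpha>) (1 - \<alpha> u)\<close> on both sides; its zeros are covered by continuity.
\<close>
lemma andrews_askey_step:
  assumes u: "u \<noteq> 0"
  shows "andrews_askey q u \<alpha> \<beta> = (1 - \<alpha> * \<beta> * u) * andrews_askey q u (q * \<alpha>) \<beta>"
proof -
  have generic: "andrews_askey q u \<gamma> \<beta> = (1 - \<gamma> * \<beta> * u) * andrews_askey q u (q * \<gamma>) \<beta>"
    if "\<gamma> \<noteq> 1" "\<gamma> \<noteq> 1 / u" for \<gamma>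
  proof -
    let ?A = "qpoch_inf q (q * \<gamma>)" and ?B = "qpoch_inf q (q * \<gamma> * u)"
    let ?a = "qpoch_inf q \<gamma>" and ?b = "qpoch_inf q (\<gamma> * u)"
    have e: "?a = (1 - \<gamma>) * ?A" "?b = (1 - \<gamma> * u) * ?B"
      using qpoch_inf_step[of \<gamma>] qpoch_inf_step[of "\<gamma> * u"] by (simp_all add: mult_ac)
    have 1: "(1 - \<gamma>) * (1 - \<gamma> * u) * jackson_sum q u 1 \<gamma> \<beta>
        = (1 - \<gamma> * \<beta> * u) * (1 - \<gamma>) * jackson_sum q u 1 (q * \<gamma>) \<beta> - \<gamma> * u * ?a * qpoch_inf q \<beta>"
      using jackson_sum_step[OF u, of 1 \<gamma> \<beta>] by (simp add: algebra_simps)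
    have 2: "(1 - \<gamma>) * (1 - \<gamma> * u) * jackson_sum q u u \<gamma> \<beta>
        = (1 - \<gamma> * \<beta> * u) * (1 - \<gamma> * u) * jackson_sum q u u (q * \<gamma>) \<beta> - \<gamma> * u * ?b * qpoch_inf q (\<beta> * u)"
      using jackson_sum_step[OF u, of u \<gamma> \<beta>] by (simp add: algebra_simps)
    have "(1 - \<gamma>) * (1 - \<gamma> * u) * andrews_askey q u \<gamma> \<beta>
      = ?b * qpoch_inf q (\<beta> * u) * ((1 - \<gamma>) * (1 - \<gamma> * u) * jackson_sum q u 1 \<gamma> \<beta>)
        - ?a * qpoch_inf q \<beta> * ((1 - \<gamma>) * (1 - \<gamma> * u) * jackson_sum q u u \<gamma> \<beta>)"
      by (simp add: andrews_askey_def algebra_simps)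
    also have "\<dots> = (1 - \<gamma>) * (1 - \<gamma> * u) * ((1 - \<gamma> * \<beta> * u) * andrews_askey q u (q * \<gamma>) \<beta>)"
      unfolding 1 2 e andrews_askey_def by (simp add: algebra_simps)
    finally show ?thesis
      using that u mult_left_cancel[of "(1 - \<gamma>) * (1 - \<gamma> * u)"] by (simp add: eq_divide_eq)
  qed
  \<comment> \<open>Both sides are continuous and agree on a punctured neighbourhood of \<open>\<alpha>\<close>.\<close>
  have "((\<lambda>\<gamma>. andrews_askey q u \<gamma> \<beta>) \<longlongrightarrow> andrews_askey q u \<alpha> \<beta>) (at \<alpha>)"
    using isCont_andrews_askey unfolding isCont_def .
  moreover have "\<forall>\<^sub>F \<gamma> in at \<alpha>. andrews_askey q u \<gamma> \<beta> = (1 - \<gamma> * \<beta> * u) * andrews_askey q u (q * \<gamma>) \<beta>"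
    using eventually_neq_at_within[of 1 \<alpha> UNIV] eventually_neq_at_within[of "1 / u" \<alpha> UNIV]
    by eventually_elim (rule generic)
  ultimately have "((\<lambda>\<gamma>. (1 - \<gamma> * \<beta> * u) * andrews_askey q u (q * \<gamma>) \<beta>)
      \<longlongrightarrow> andrews_askey q u \<alpha> \<beta>) (at \<alpha>)"
    by (rule Lim_transform_eventually)
  moreover have "((\<lambda>\<gamma>. (1 - \<gamma> * \<beta> * u) * andrews_askey q u (q * \<gamma>) \<beta>)
      \<longlongrightarrow> (1 - \<alpha> * \<beta> * u) * andrews_askey q u (q * \<alpha>) \<beta>) (at \<alpha>)"
    by (intro tendsto_intros isCont_tendsto_compose[OF isCont_andrews_askey])
  ultimately show ?thesis
    by (rule tendsto_unique[rotated]) simp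
qed

lemma andrews_askey_reduce:
  assumes u: "u \<noteq> 0"
  shows "andrews_askey q u \<alpha> \<beta> = qpoch_inf q (\<alpha> * \<beta> * u) * andrews_askey q u 0 \<beta>"
proof -
  have it: "andrews_askey q u \<alpha> \<beta> = qpoch q (\<alpha> * \<beta> * u) n * andrews_askey q u (q ^ n * \<alpha>) \<beta>" for n
  proof (induction n)
    case (Suc n)
    then show ?case
      using andrews_askey_step[OF u, of "q ^ n * \<alpha>" \<beta>] by (simp add: qpoch_Suc mult_ac)
  qed simp
  have "(\<lambda>n. qpoch q (\<alpha> * \<beta> * u) n * andrews_askey q u (q ^ n * \<alpha>) \<beta>)
      \<longlonglongrightarrow> qpoch_inf q (\<alpha> * \<beta> * u) * andrews_askey q u 0 \<beta>"
    by (intro tendsto_mult qpoch_tendsto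
        isCont_tendsto_compose[OF isCont_andrews_askey power_mult_tendsto_zero])
  then show ?thesis
    unfolding it[symmetric] by (rule LIMSEQ_unique[OF tendsto_const])
qed

lemma andrews_askey_commute: "andrews_askey q u \<alpha> \<beta> = andrews_askey q u \<beta> \<alpha>"
  by (simp add: andrews_askey_def jackson_sum_def jackson_weight_def mult_ac)

text \<open>
  By the recursion in \<open>\<alpha>\<close>, and in \<open>\<beta>\<close> by symmetry, everything reduces to \<open>\<alpha> = \<beta> = 0\<close>. That constant is
  read off from the one choice \<open>\<alpha> = q\<close>, \<open>\<beta> = q/u\<close>, for which the original integrand is constant and
  both halves are geometric series.
\<close>
lemma andrews_askey_eval:
  assumes u: "u \<noteq> 0"
  shows "andrews_askey q u \<alpha> \<beta> = qpoch_inf q q * qpoch_inf q u * qpoch_inf q (q / u) * qpoch_inf q (\<alpha> * \<beta> * u)"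
proof -
  have red: "andrews_askey q u \<alpha> \<beta> = qpoch_inf q (\<alpha> * \<beta> * u) * andrews_askey q u 0 0" for \<alpha> \<beta>
    using andrews_askey_reduce[OF u, of \<alpha> \<beta>] andrews_askey_reduce[OF u, of \<beta> 0]
    by (simp add: andrews_askey_commute[of u 0 \<beta>] qpoch_inf_zero)
  have nq: "q \<noteq> 1" "1 - q \<noteq> 0" using q1 by auto
  have geo: "(\<lambda>k. c * q ^ k) sums (c * (1 / (1 - q)))" for c
    by (intro sums_mult geometric_sums q1)
  have w1: "jackson_weight q u 1 q (q / u) k = qpoch_inf q q * qpoch_inf q (q / u)" for k
    using qpoch_inf_split[of q k] qpoch_inf_split[of "q / u" k]
    by (simp add: jackson_weight_def mult_ac)
  have w2: "jackson_weight q u u q (q / u) k = qpoch_inf q q * qpoch_inf q (q * u)" for k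
    using qpoch_inf_split[of q k] qpoch_inf_split[of "q * u" k] u
    by (simp add: jackson_weight_def mult_ac)
  have j1: "jackson_sum q u 1 q (q / u) = qpoch_inf q q * qpoch_inf q (q / u) / (1 - q)"
    unfolding jackson_sum_def w1 using sums_unique[OF geo[of "qpoch_inf q q * qpoch_inf q (q / u)"]]
    by (simp add: mult_ac)
  have j2: "jackson_sum q u u q (q / u) = u * qpoch_inf q q * qpoch_inf q (q * u) / (1 - q)"
    unfolding jackson_sum_def w2 using sums_unique[OF geo[of "u * qpoch_inf q q * qpoch_inf q (q * u)"]]
    by (simp add: mult_ac)
  have qq: "qpoch_inf q q = (1 - q) * qpoch_inf q (q * q)" and uu: "qpoch_inf q u = (1 - u) * qpoch_inf q (q * u)"
    by (rule qpoch_inf_step)+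
  have nz: "qpoch_inf q (q * q) \<noteq> 0" using qq qpoch_inf_q_nonzero by auto
  have "andrews_askey q u q (q / u)
      = qpoch_inf q q * qpoch_inf q u * qpoch_inf q (q / u) * qpoch_inf q (q * q)"
    unfolding andrews_askey_def j1 j2 uu using u nq
    by (simp add: qq) (simp add: field_simps)
  moreover have "andrews_askey q u q (q / u) = qpoch_inf q (q * q) * andrews_askey q u 0 0"
    using red[of q "q / u"] u by simp
  ultimately have "andrews_askey q u 0 0 = qpoch_inf q q * qpoch_inf q u * qpoch_inf q (q / u)"
    using nz by simp
  then show ?thesis by (subst red) (simp add: mult_ac)
qed

end

section \<open>The nonterminating three-term relation\<close>

lemma phi32_swap12: "phi32 a b c d e q z = phi32 b a c d e q z"
  by (simp add: phi32_def qpochs_def mult_ac)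

lemma phi32_swap23: "phi32 a b c d e q z = phi32 a c b d e q z"
  by (simp add: phi32_def qpochs_def mult_ac)

lemma phi32_swap_lower: "phi32 a b c d e q z = phi32 a b c e d q z"
  by (simp add: phi32_def qpochs_def mult_ac)

context q_series
begin

text \<open>
  \<open>newton q n 0\<close> is \<open>(-1)\<^sup>n q\<^bsup>n(n-1)/2\<^esup>\<close>; the lemma is \<open>q\<^sup>n t - q\<^sup>i = - q\<^sup>i (1 - q\<^bsup>n-i\<^esup> t)\<close> taken
  over \<open>i < n\<close>.
\<close>
lemma newton_qpoch: "newton q n (q ^ n * t) = newton q n 0 * qpoch q (q * t) n"
proof (induction n)
  case (Suc n)
  have "newton q (Suc n) (q ^ Suc n * t) = q ^ n * (q * (q ^ n * t) - 1) * newton q n (q ^ n * t)"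
    using newton_shift[of n "q ^ n * t"] by (simp add: mult_ac)
  then show ?case
    unfolding Suc.IH by (simp add: newton_Suc[of n 0] qpoch_Suc algebra_simps)
qed simp

lemma newton_qpoch_inf:
  "newton q n (q ^ n * t) * qpoch_inf q (q ^ n * (q * t)) = newton q n 0 * qpoch_inf q (q * t)"
  unfolding newton_qpoch qpoch_inf_split[of "q * t" n] by (simp only: mult_ac)

text \<open>
  Reversal of the order of the factors, \<open>q\<^sup>j (1 - u/q\<^sup>j) = - u (1 - q\<^sup>j/u)\<close> for \<open>1 \<le> j \<le> n\<close>, up to
  powers of \<open>q\<close>.
\<close>
lemma qpoch_reflect:
  assumes "u \<noteq> 0"
  shows "newton q n 0 * q ^ n * qpoch q (u / q ^ n) n = u ^ n * qpoch q (q / u) n"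
proof (induction n)
  case (Suc n)
  have "qpoch q (u / q ^ Suc n) (Suc n) = (1 - u / q ^ Suc n) * qpoch q (u / q ^ n) n"
    using q0 by (simp add: qpoch_Suc_shift)
  then have "newton q (Suc n) 0 * q ^ Suc n * qpoch q (u / q ^ Suc n) (Suc n)
      = - (q ^ Suc n * (1 - u / q ^ Suc n)) * (newton q n 0 * q ^ n * qpoch q (u / q ^ n) n)"
    by (simp add: newton_Suc mult_ac)
  also have "- (q ^ Suc n * (1 - u / q ^ Suc n)) = u * (1 - q ^ n * (q / u))"
    using q0 assms by (simp add: field_simps)
  finally show ?case
    unfolding Suc.IH by (simp add: qpoch_Suc mult_ac)
qed simp

text \<open>
  The moment of the \<open>n\<close>-th Newton polynomial with respect to the weight of
  \<open>andrews_askey q u b c\<close>. The factor \<open>1 *\<close> keeps the two halves of the same shape, with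
  starting points \<open>s = 1\<close> and \<open>s = u\<close>, so that lemmas about a general \<open>s\<close> apply to both.
\<close>
definition newton_moment :: "complex \<Rightarrow> complex \<Rightarrow> complex \<Rightarrow> nat \<Rightarrow> complex" where
  "newton_moment u b c n =
     qpoch_inf q (b * u) * qpoch_inf q (c * u)
       * (\<Sum>m. 1 * q ^ m * jackson_weight q u 1 b c m * newton q n (q ^ m * 1))
     - qpoch_inf q b * qpoch_inf q c
       * (\<Sum>m. u * q ^ m * jackson_weight q u u b c m * newton q n (q ^ m * u))"

text \<open>
  In the first half the terms with \<open>m < n\<close> vanish and the sum starts at \<open>t = q\<^sup>n\<close>. After the
  substitution \<open>t = q\<^sup>n t'\<close> the interval \<open>[u, q\<^sup>n]\<close> becomes \<open>[u/q\<^sup>n, 1]\<close>, and the Newton polynomial is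
  absorbed by the factor \<open>(qt; q)\<^sub>\<infinity>\<close> of the weight.
\<close>
lemma newton_moment_eq_andrews_askey:
  assumes u: "u \<noteq> 0"
  shows "newton_moment u b c n = newton q n 0 * q ^ n * qpoch q b n * qpoch q c n
           * andrews_askey q (u / q ^ n) (b * q ^ n) (c * q ^ n)"
proof -
  define v where "v = u / q ^ n"
  have uv: "u = q ^ n * v" and v: "v \<noteq> 0" using q0 u by (auto simp: v_def)
  have qn: "q ^ n \<noteq> 0" using q0 by simp
  let ?S = "newton q n 0 * q ^ n * qpoch q b n * qpoch q c n"
  have w1: "1 * q ^ (j + n) * jackson_weight q u 1 b c (j + n) * newton q n (q ^ (j + n) * 1)
      = ?S * (1 * q ^ j * jackson_weight q v 1 (b * q ^ n) (c * q ^ n) j)" for j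
  proof -
    have 1: "qpoch_inf q (q ^ Suc (j + n) * 1) * newton q n (q ^ (j + n) * 1)
        = newton q n 0 * qpoch_inf q (q ^ Suc j * 1)"
      using newton_qpoch_inf[of n "q ^ j"] by (simp add: power_add mult_ac)
    have 2: "q ^ Suc (j + n) * 1 / u = q ^ Suc j * 1 / v"
      using qn v by (simp add: uv power_add field_simps)
    have 3: "qpoch q (x * 1) (j + n) = qpoch q x n * qpoch q (x * q ^ n * 1) j" for x
      using qpoch_add[of q x n j] by (simp add: add.commute mult.commute)
    have "1 * q ^ (j + n) * jackson_weight q u 1 b c (j + n) * newton q n (q ^ (j + n) * 1)
      = q ^ j * q ^ n * (qpoch_inf q (q ^ Suc (j + n) * 1) * newton q n (q ^ (j + n) * 1))
         * qpoch_inf q (q ^ Suc (j + n) * 1 / u) * qpoch q (b * 1) (j + n) * qpoch q (c * 1) (j + n)"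
      unfolding jackson_weight_def power_add by (simp only: mult_ac mult_1_left mult_1_right)
    also have "\<dots> = ?S * (1 * q ^ j * jackson_weight q v 1 (b * q ^ n) (c * q ^ n) j)"
      unfolding 1 2 3 jackson_weight_def by (simp only: mult_ac mult_1_left mult_1_right)
    finally show ?thesis .
  qed
  have w2: "u * q ^ m * jackson_weight q u u b c m * newton q n (q ^ m * u)
      = newton q n 0 * q ^ n * (v * q ^ m * jackson_weight q v v (b * q ^ n) (c * q ^ n) m)" for m
  proof -
    have 1: "qpoch_inf q (q ^ Suc m * u) * newton q n (q ^ m * u)
        = newton q n 0 * qpoch_inf q (q ^ Suc m * v)"
      using newton_qpoch_inf[of n "q ^ m * v"] by (simp add: uv mult_ac)
    have 2: "q ^ Suc m * u / u = q ^ Suc m * v / v" using u v by simp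
    have 3: "x * u = x * q ^ n * v" for x by (simp add: uv)
    have "u * q ^ m * jackson_weight q u u b c m * newton q n (q ^ m * u)
       = u * q ^ m * (qpoch_inf q (q ^ Suc m * u) * newton q n (q ^ m * u))
           * qpoch_inf q (q ^ Suc m * u / u) * qpoch q (b * u) m * qpoch q (c * u) m"
      unfolding jackson_weight_def by (simp only: mult_ac)
    also have "\<dots> = newton q n 0 * q ^ n * (v * q ^ m * jackson_weight q v v (b * q ^ n) (c * q ^ n) m)"
      unfolding 1 2 3[of b] 3[of c] jackson_weight_def by (simp add: uv mult_ac)
    finally show ?thesis .
  qed
  have s1: "(\<Sum>m. 1 * q ^ m * jackson_weight q u 1 b c m * newton q n (q ^ m * 1))
      = ?S * jackson_sum q v 1 (b * q ^ n) (c * q ^ n)"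
  proof -
    have "(\<lambda>j. ?S * (1 * q ^ j * jackson_weight q v 1 (b * q ^ n) (c * q ^ n) j))
        sums (?S * jackson_sum q v 1 (b * q ^ n) (c * q ^ n))"
      unfolding jackson_sum_def by (intro sums_mult summable_sums jackson_term_summable)
    then have "(\<lambda>j. 1 * q ^ (j + n) * jackson_weight q u 1 b c (j + n) * newton q n (q ^ (j + n) * 1))
        sums (?S * jackson_sum q v 1 (b * q ^ n) (c * q ^ n))"
      unfolding w1 .
    moreover have "(\<Sum>m<n. 1 * q ^ m * jackson_weight q u 1 b c m * newton q n (q ^ m * 1)) = 0"
      by (intro sum.neutral) (auto simp: newton_eq_0)
    ultimately show ?thesis
      by (subst (asm) sums_iff_shift) (simp add: sums_iff)
  qed
  have s2: "(\<Sum>m. u * q ^ m * jackson_weight q u u b c m * newton q n (q ^ m * u))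
      = newton q n 0 * q ^ n * jackson_sum q v v (b * q ^ n) (c * q ^ n)"
    unfolding w2 jackson_sum_def by (intro suminf_mult jackson_term_summable)
  have e: "qpoch_inf q x = qpoch q x n * qpoch_inf q (x * q ^ n)" for x
    using qpoch_inf_split[of x n] by (simp add: mult.commute)
  have "newton_moment u b c n =
      qpoch_inf q (b * q ^ n * v) * qpoch_inf q (c * q ^ n * v) * (?S * jackson_sum q v 1 (b * q ^ n) (c * q ^ n))
      - (qpoch q b n * qpoch_inf q (b * q ^ n)) * (qpoch q c n * qpoch_inf q (c * q ^ n))
          * (newton q n 0 * q ^ n * jackson_sum q v v (b * q ^ n) (c * q ^ n))"
    unfolding newton_moment_def s1 s2 e[of b, symmetric] e[of c, symmetric] by (simp add: uv mult_ac)
  also have "\<dots> = ?S * andrews_askey q v (b * q ^ n) (c * q ^ n)"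
    unfolding andrews_askey_def by (simp add: algebra_simps)
  finally show ?thesis by (simp add: v_def)
qed

text \<open>
  The dependence on \<open>n\<close> is that of \<open>u\<^sup>n (b, c; q)\<^sub>n / (bcu; q)\<^sub>n\<close>, which supplies the parameters \<open>b\<close>,
  \<open>c\<close> and \<open>e = bcu\<close> of the series \<open>\<^sub>3\<phi>\<^sub>2\<close> to be built.
\<close>
lemma newton_moment_eval:
  assumes u: "u \<noteq> 0"
  shows "newton_moment u b c n * qpoch q (b * c * u) n
    = qpoch q b n * qpoch q c n * u ^ n
        * (qpoch_inf q q * qpoch_inf q u * qpoch_inf q (q / u) * qpoch_inf q (b * c * u))"
proof -
  have v: "u / q ^ n \<noteq> 0" using u q0 by simp
  \<comment> \<open>Each product in the Andrews--Askey evaluation loses a finite part to the shift by \<open>q\<^sup>n\<close>.\<close>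
  have 1: "qpoch_inf q (u / q ^ n) = qpoch q (u / q ^ n) n * qpoch_inf q u"
    using qpoch_inf_split[of "u / q ^ n" n] q0 by simp
  have 2: "qpoch_inf q (q / u) = qpoch q (q / u) n * qpoch_inf q (q / (u / q ^ n))"
    using qpoch_inf_split[of "q / u" n] by (simp add: mult.commute)
  have 3: "qpoch_inf q (b * c * u)
      = qpoch q (b * c * u) n * qpoch_inf q (b * q ^ n * (c * q ^ n) * (u / q ^ n))"
    using qpoch_inf_split[of "b * c * u" n] q0 by (simp add: mult_ac)
  let ?X = "qpoch_inf q q * qpoch_inf q (q / (u / q ^ n)) * qpoch_inf q u
     * qpoch_inf q (b * q ^ n * (c * q ^ n) * (u / q ^ n)) * qpoch q (b * c * u) n
     * qpoch q b n * qpoch q c n"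
  have "newton_moment u b c n * qpoch q (b * c * u) n
      = (newton q n 0 * q ^ n * qpoch q (u / q ^ n) n) * ?X"
    unfolding newton_moment_eq_andrews_askey[OF u] andrews_askey_eval[OF v] 1 by (simp only: mult_ac)
  also have "\<dots> = (u ^ n * qpoch q (q / u) n) * ?X"
    unfolding qpoch_reflect[OF u] ..
  also have "\<dots> = qpoch q b n * qpoch q c n * u ^ n
        * (qpoch_inf q q * qpoch_inf q u * qpoch_inf q (q / u) * qpoch_inf q (b * c * u))"
    unfolding 2 3 by (simp only: mult_ac)
  finally show ?thesis .
qed

lemma jackson_term_weighted_bound:
  obtains C where "C > 0"
    "\<And>k x K. norm x \<le> K \<Longrightarrow> norm (s * q ^ k * jackson_weight q u s b c k * x) \<le> C * norm q ^ k * K"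
proof -
  obtain C where C: "C > 0"
    "\<And>\<alpha> k. norm \<alpha> \<le> norm b \<Longrightarrow> norm (s * q ^ k * jackson_weight q u s \<alpha> c k) \<le> C * norm q ^ k"
    using jackson_term_bound[of "norm b" s u c] by metis
  show ?thesis
  proof (rule that[OF C(1)])
    fix k and x :: complex and K assume x: "norm x \<le> K"
    show "norm (s * q ^ k * jackson_weight q u s b c k * x) \<le> C * norm q ^ k * K"
      unfolding norm_mult[of _ x] using C x by (intro mult_mono) auto
  qed
qed

lemma jackson_term_weighted_summable:
  assumes "\<And>m. norm (g m) \<le> K"
  shows "summable (\<lambda>m. s * q ^ m * jackson_weight q u s b c m * g m)"
proof -
  obtain C where C: "C > 0"
    "\<And>k x K. norm x \<le> K \<Longrightarrow> norm (s * q ^ k * jackson_weight q u s b c k * x) \<le> C * norm q ^ k * K"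
    using jackson_term_weighted_bound[of s u b c] by metis
  show ?thesis
    by (rule summable_comparison_test[of _ "\<lambda>m. C * norm q ^ m * K"])
       (use C assms in \<open>auto intro!: summable_mult2 summable_const_norm_power\<close>)
qed

lemma jackson_term_weighted_tendsto:
  assumes "\<And>m. (\<lambda>N. g N m) \<longlonglongrightarrow> h m" and "\<And>N m. norm (g N m) \<le> K"
  shows "(\<lambda>N. \<Sum>m. s * q ^ m * jackson_weight q u s b c m * g N m)
           \<longlonglongrightarrow> (\<Sum>m. s * q ^ m * jackson_weight q u s b c m * h m)"
proof -
  obtain C where C: "C > 0"
    "\<And>k x K. norm x \<le> K \<Longrightarrow> norm (s * q ^ k * jackson_weight q u s b c k * x) \<le> C * norm q ^ k * K"
    using jackson_term_weighted_bound[of s u b c] by metis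
  show ?thesis
  proof (rule tannery)
    show "\<forall>\<^sub>F N in sequentially. \<forall>m. norm (s * q ^ m * jackson_weight q u s b c m * g N m) \<le> C * norm q ^ m * K"
      using C assms(2) by (intro always_eventually) blast
    show "summable (\<lambda>m. C * norm q ^ m * K)" by (intro summable_mult2 summable_const_norm_power)
    show "(\<lambda>N. s * q ^ m * jackson_weight q u s b c m * g N m)
      \<longlonglongrightarrow> s * q ^ m * jackson_weight q u s b c m * h m" for m
      by (intro tendsto_mult_left assms)
  qed simp
qed

lemma gauss_partial_sum_bounded:
  assumes "a \<noteq> 0" "qpoch_inf q d \<noteq> 0" "norm (d * t / a) < 1"
  obtains K where "\<And>N s. norm s \<le> norm t \<Longrightarrow> norm (\<Sum>n<N. gauss_term q a d s n) \<le> K"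
proof -
  obtain C \<rho> where \<rho>: "0 \<le> \<rho>" "\<rho> < 1" "0 < C"
    and b: "\<And>n s. norm s \<le> norm t \<Longrightarrow> norm (gauss_term q a d s n) \<le> C * \<rho> ^ n"
    using gauss_term_geometric_bound[OF assms] by metis
  have sm: "summable (\<lambda>n. C * \<rho> ^ n)" using \<rho> by (intro summable_mult summable_geometric) auto
  show ?thesis
  proof (rule that)
    fix N and s :: complex assume s: "norm s \<le> norm t"
    have "norm (\<Sum>n<N. gauss_term q a d s n) \<le> (\<Sum>n<N. C * \<rho> ^ n)"
      by (intro sum_norm_le b s)
    also have "\<dots> \<le> (\<Sum>n. C * \<rho> ^ n)"
      using \<rho> by (intro sum_le_suminf sm) auto
    finally show "norm (\<Sum>n<N. gauss_term q a d s n) \<le> (\<Sum>n. C * \<rho> ^ n)" .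
  qed
qed

text \<open>
  A bound on all partial sums at all nodes \<open>q\<^sup>m\<close>. From some node on they lie in the disc of convergence
  and share one geometric majorant; each of the finitely many nodes before that has its own bound.
\<close>
lemma gauss_partial_sum_power_bounded:
  assumes "a \<noteq> 0" "qpoch_inf q d \<noteq> 0"
  obtains K where "\<And>N m. norm (\<Sum>n<N. gauss_term q a d (q ^ m) n) \<le> K"
proof -
  obtain M where M: "norm (d * q ^ M / a) < 1"
    using power_in_disc[of d a] .
  obtain K1 where K1: "\<And>N s. norm s \<le> norm (q ^ M) \<Longrightarrow> norm (\<Sum>n<N. gauss_term q a d s n) \<le> K1"
    using gauss_partial_sum_bounded[OF assms M] by metis
  have "\<exists>K. \<forall>N. norm (\<Sum>n<N. gauss_term q a d (q ^ m) n) \<le> K" for m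
  proof -
    have "Bseq (\<lambda>N. \<Sum>n<N. gauss_term q a d (q ^ m) n)"
      using summable_LIMSEQ[OF gauss_term_power_summable[OF assms]]
      by (intro convergent_imp_Bseq) (auto simp: convergent_def)
    then show ?thesis by (auto simp: Bseq_def)
  qed
  then obtain K where K: "\<And>m N. norm (\<Sum>n<N. gauss_term q a d (q ^ m) n) \<le> K m" by metis
  show ?thesis
  proof (rule that)
    fix N m
    have K0: "0 \<le> K m" for m using order_trans[OF norm_ge_zero K] .
    have K10: "0 \<le> K1" using order_trans[OF norm_ge_zero K1[of "q ^ M" 0]] by simp
    show "norm (\<Sum>n<N. gauss_term q a d (q ^ m) n) \<le> K1 + (\<Sum>m<M. K m)"
    proof (cases "m < M")
      case True
      then have "K m \<le> (\<Sum>m<M. K m)" by (intro member_le_sum) (use K0 in auto)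
      then show ?thesis using K[of m N] K10 by linarith
    next
      case False
      then have "norm (q ^ m) \<le> norm (q ^ M)"
        using q1 by (simp add: norm_power power_decreasing)
      then show ?thesis using K1[of "q ^ m" N] sum_nonneg[of "{..<M}" K] K0 by force
    qed
  qed
qed

text \<open>
  Termwise integration of the q-Gauss expansion. It is justified by Tannery's theorem for the partial
  sums, which are uniformly bounded at the nodes while the weights decay like \<open>norm q ^ m\<close>.
\<close>
lemma gauss_moment_expansion:
  assumes a: "a \<noteq> 0" and u: "u \<noteq> 0" and d: "qpoch_inf q d \<noteq> 0" and z: "norm (d * u / a) < 1"
  shows "(\<lambda>n. qpoch q a n / (qpoch q q n * qpoch q d n) * (d / a) ^ n * newton_moment u b c n)
    sums (qpoch_inf q (b * u) * qpoch_inf q (c * u)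
            * (\<Sum>m. 1 * q ^ m * jackson_weight q u 1 b c m * gauss_sum a d (q ^ m * 1))
          - qpoch_inf q b * qpoch_inf q c
            * (\<Sum>m. u * q ^ m * jackson_weight q u u b c m * gauss_sum a d (q ^ m * u)))"
  unfolding sums_def
proof -
  let ?A = "\<lambda>n. qpoch q a n / (qpoch q q n * qpoch q d n) * (d / a) ^ n"
  let ?S = "\<lambda>N t. \<Sum>n<N. gauss_term q a d t n"
  \<comment> \<open>Only a finite sum is interchanged with an infinite one.\<close>
  have swap: "(\<Sum>n<N. ?A n * (\<Sum>m. s * q ^ m * jackson_weight q u s b c m * newton q n (q ^ m * s)))
      = (\<Sum>m. s * q ^ m * jackson_weight q u s b c m * ?S N (q ^ m * s))" for s N
  proof -
    let ?w = "\<lambda>m. s * q ^ m * jackson_weight q u s b c m"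
    have sm: "summable (\<lambda>m. ?w m * newton q n (q ^ m * s))" for n
    proof (rule jackson_term_weighted_summable)
      show "norm (newton q n (q ^ m * s))
          \<le> (norm s + 1) ^ n * exp ((1 / (norm s + 1)) / (1 - norm q))" for m
        using norm_power_mult_le[of m s] by (intro norm_newton_le) (auto simp: add_nonneg_pos)
    qed
    have "(\<Sum>n<N. ?A n * (\<Sum>m. ?w m * newton q n (q ^ m * s)))
        = (\<Sum>n<N. \<Sum>m. ?A n * (?w m * newton q n (q ^ m * s)))"
      by (intro sum.cong refl suminf_mult[symmetric] sm)
    also have "\<dots> = (\<Sum>m. \<Sum>n<N. ?A n * (?w m * newton q n (q ^ m * s)))"
      by (intro suminf_sum[symmetric] summable_mult sm)
    also have "\<dots> = (\<Sum>m. ?w m * ?S N (q ^ m * s))"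
      unfolding gauss_term_def sum_distrib_left by (simp only: mult_ac)
    finally show ?thesis .
  qed
  show "(\<lambda>N. \<Sum>n<N. ?A n * newton_moment u b c n) \<longlonglongrightarrow>
      qpoch_inf q (b * u) * qpoch_inf q (c * u)
            * (\<Sum>m. 1 * q ^ m * jackson_weight q u 1 b c m * gauss_sum a d (q ^ m * 1))
          - qpoch_inf q b * qpoch_inf q c
            * (\<Sum>m. u * q ^ m * jackson_weight q u u b c m * gauss_sum a d (q ^ m * u))"
  proof -
    have eq: "(\<Sum>n<N. ?A n * newton_moment u b c n) =
        qpoch_inf q (b * u) * qpoch_inf q (c * u)
            * (\<Sum>m. 1 * q ^ m * jackson_weight q u 1 b c m * ?S N (q ^ m * 1))
          - qpoch_inf q b * qpoch_inf q c
            * (\<Sum>m. u * q ^ m * jackson_weight q u u b c m * ?S N (q ^ m * u))" for N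
      unfolding newton_moment_def swap[symmetric]
      unfolding sum_distrib_left sum_subtractf[symmetric]
      by (intro sum.cong refl) (simp only: right_diff_distrib mult_ac)
    obtain K1 where K1: "\<And>N m. norm (?S N (q ^ m)) \<le> K1"
      using gauss_partial_sum_power_bounded[OF a d] by metis
    obtain K2 where K2: "\<And>N s. norm s \<le> norm u \<Longrightarrow> norm (?S N s) \<le> K2"
      using gauss_partial_sum_bounded[OF a d z] by metis
    have zm: "norm (d * (q ^ m * u) / a) < 1" for m
      using norm_power_mult_le[of m "d * u / a"] z by (simp add: mult_ac)
    show ?thesis
      unfolding eq
    proof (intro tendsto_diff tendsto_mult_left jackson_term_weighted_tendsto)
      show "(\<lambda>N. ?S N (q ^ m * 1)) \<longlonglongrightarrow> gauss_sum a d (q ^ m * 1)" for m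
        using summable_LIMSEQ[OF gauss_term_power_summable[OF a d]] by simp
      show "norm (?S N (q ^ m * 1)) \<le> K1" for N m using K1 by simp
      show "(\<lambda>N. ?S N (q ^ m * u)) \<longlonglongrightarrow> gauss_sum a d (q ^ m * u)" for m
        by (intro summable_LIMSEQ gauss_term_summable[OF a d] zm)
      show "norm (?S N (q ^ m * u)) \<le> K2" for N m
        by (intro K2 norm_power_mult_le)
    qed
  qed
qed

text \<open>
  The coefficients converge, hence are bounded, and the powers of \<open>z\<close> form a geometric series.
\<close>
lemma phi32_summable:
  assumes "qpoch_inf q v \<noteq> 0" "qpoch_inf q v' \<noteq> 0" "norm z < 1"
  shows "summable (\<lambda>m. qpochs q [x, y, w] m / (qpoch q q m * qpochs q [v, v'] m) * z ^ m)"
proof -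
  have "(\<lambda>m. qpochs q [x, y, w] m / (qpoch q q m * qpochs q [v, v'] m))
    \<longlonglongrightarrow> qpochs_inf q [x, y, w] / (qpoch_inf q q * qpochs_inf q [v, v'])"
    unfolding qpochs_def qpochs_inf_def using assms
    by (auto intro!: tendsto_intros qpoch_tendsto)
  then have "Bseq (\<lambda>m. qpochs q [x, y, w] m / (qpoch q q m * qpochs q [v, v'] m))"
    by (intro convergent_imp_Bseq) (auto simp: convergent_def)
  then obtain B where B: "\<And>m. norm (qpochs q [x, y, w] m / (qpoch q q m * qpochs q [v, v'] m)) \<le> B"
    unfolding Bseq_def by blast
  have "summable (\<lambda>m. B * norm z ^ m)"
    using assms(3) by (intro summable_mult summable_geometric) simp
  then show ?thesis
  proof (rule summable_comparison_test[rotated], intro exI allI impI)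
    fix m
    show "norm (qpochs q [x, y, w] m / (qpoch q q m * qpochs q [v, v'] m) * z ^ m) \<le> B * norm z ^ m"
      unfolding norm_mult norm_power by (intro mult_right_mono B) simp
  qed
qed

text \<open>
  The expansion of \<open>gauss_moment_expansion\<close> with everything evaluated: the moments on the one side, the
  values of the q-Gauss sum at the nodes on the other. With \<open>u = e/(bc)\<close> this is (III.34) of Gasper
  and Rahman.
\<close>
lemma nonterminating_phi32_three_term:
  assumes a: "a \<noteq> 0" and u0: "u \<noteq> 0" and e: "e = b * c * u" and z: "norm (d * u / a) < 1"
    and d: "qpoch_inf q d \<noteq> 0" and e0: "qpoch_inf q e \<noteq> 0" and du: "qpoch_inf q (d * u) \<noteq> 0"
    and u: "qpoch_inf q u \<noteq> 0" "qpoch_inf q (1 / u) \<noteq> 0"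
  shows "phi32 a b c d e q (d * u / a) =
    qpoch_inf q (b * u) * qpoch_inf q (c * u) / (qpoch_inf q e * qpoch_inf q u)
      * phi32 (d / a) b c d (q / u) q q
    + qpoch_inf q b * qpoch_inf q c * qpoch_inf q (d / a) * qpoch_inf q (d * u)
        / (qpoch_inf q d * qpoch_inf q e * qpoch_inf q (1 / u) * qpoch_inf q (d * u / a))
      * phi32 (b * u) (c * u) (d * u / a) (d * u) (q * u) q q"
proof -
  let ?K = "qpoch_inf q q * qpoch_inf q u * qpoch_inf q (q / u) * qpoch_inf q e"
  have uu: "qpoch_inf q u = (1 - u) * qpoch_inf q (q * u)"
    "qpoch_inf q (1 / u) = (1 - 1 / u) * qpoch_inf q (q / u)"
    using qpoch_inf_step[of u] qpoch_inf_step[of "1 / u"] by simp_all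
  then have nz: "qpoch_inf q (q * u) \<noteq> 0" "qpoch_inf q (q / u) \<noteq> 0" "1 - u \<noteq> 0"
    using u by auto
  have duz: "qpoch_inf q (d * u / a) \<noteq> 0" by (rule qpoch_inf_nonzero[OF z])
  have zm: "norm (d * (q ^ m * u) / a) < 1" for m
    using norm_power_mult_le[of m "d * u / a"] z by (simp add: mult_ac)
  have tail: "qpoch_inf q (q ^ m * x) = qpoch_inf q x / qpoch q x m" if "qpoch_inf q x \<noteq> 0" for x m
    using qpoch_inf_split[of x m] qpoch_nonzero[OF that, of m] by simp
  have lhs: "qpoch q a n / (qpoch q q n * qpoch q d n) * (d / a) ^ n * newton_moment u b c n
      = ?K * (qpochs q [a, b, c] n / (qpoch q q n * qpochs q [d, e] n) * (d * u / a) ^ n)" for n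
  proof -
    have "newton_moment u b c n = qpoch q b n * qpoch q c n * u ^ n * ?K / qpoch q e n"
      using newton_moment_eval[OF u0, of b c n] qpoch_nonzero[OF e0, of n] by (simp add: e field_simps)
    then show ?thesis
      by (simp add: qpochs_def power_divide power_mult_distrib mult_ac)
  qed
  have one: "1 * q ^ m * jackson_weight q u 1 b c m * gauss_sum a d (q ^ m * 1)
      = qpoch_inf q q * qpoch_inf q (q / u)
         * (qpochs q [d / a, b, c] m / (qpoch q q m * qpochs q [d, q / u] m) * q ^ m)" for m
  proof -
    have 1: "qpoch_inf q (q ^ Suc m * 1) = qpoch_inf q q / qpoch q q m"
      using tail[of q m] by (simp add: mult.commute)
    have 2: "qpoch_inf q (q ^ Suc m * 1 / u) = qpoch_inf q (q / u) / qpoch q (q / u) m"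
      using tail[OF nz(2), of m] by (simp add: mult.commute)
    show ?thesis
      using gauss_sum_power[OF a d, of m] unfolding jackson_weight_def 1 2 by (simp add: qpochs_def mult_ac)
  qed
  have two: "u * q ^ m * jackson_weight q u u b c m * gauss_sum a d (q ^ m * u)
      = u * qpoch_inf q q * qpoch_inf q (q * u) * qpoch_inf q (d / a) * qpoch_inf q (d * u)
           / (qpoch_inf q d * qpoch_inf q (d * u / a))
         * (qpochs q [b * u, c * u, d * u / a] m / (qpoch q q m * qpochs q [d * u, q * u] m) * q ^ m)" for m
  proof -
    have 1: "qpoch_inf q (q ^ Suc m * u) = qpoch_inf q (q * u) / qpoch q (q * u) m"
      using tail[OF nz(1), of m] by (simp add: mult_ac)
    have 2: "qpoch_inf q (q ^ Suc m * u / u) = qpoch_inf q q / qpoch q q m"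
      using tail[of q m] u0 by (simp add: mult.commute)
    have 3: "qpoch_inf q (d * (q ^ m * u)) = qpoch_inf q (d * u) / qpoch q (d * u) m"
      using tail[OF du, of m] by (simp add: mult_ac)
    have 4: "qpoch_inf q (d * (q ^ m * u) / a) = qpoch_inf q (d * u / a) / qpoch q (d * u / a) m"
      using tail[OF duz, of m] by (simp add: mult_ac)
    show ?thesis
      unfolding gauss_sum_eq[OF a d zm] 3 4 jackson_weight_def 1 2
      using qpoch_nonzero[OF duz, of m] by (simp add: qpochs_def mult_ac)
  qed
  let ?\<phi>1 = "phi32 (d / a) b c d (q / u) q q"
  let ?\<phi>2 = "phi32 (b * u) (c * u) (d * u / a) (d * u) (q * u) q q"
  let ?R = "qpoch_inf q (b * u) * qpoch_inf q (c * u)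
            * (qpoch_inf q q * qpoch_inf q (q / u) * ?\<phi>1)
          - qpoch_inf q b * qpoch_inf q c
            * (u * qpoch_inf q q * qpoch_inf q (q * u) * qpoch_inf q (d / a) * qpoch_inf q (d * u)
               / (qpoch_inf q d * qpoch_inf q (d * u / a)) * ?\<phi>2)"
  have "(\<lambda>n. ?K * (qpochs q [a, b, c] n / (qpoch q q n * qpochs q [d, e] n) * (d * u / a) ^ n))
    sums ?R"
    using gauss_moment_expansion[OF a u0 d z, of b c]
    unfolding lhs one two phi32_def
      suminf_mult[OF phi32_summable[OF d nz(2) q1]] suminf_mult[OF phi32_summable[OF du nz(1) q1]] .
  from sums_mult[OF this, of "1 / ?K"]
  have "(\<lambda>n. qpochs q [a, b, c] n / (qpoch q q n * qpochs q [d, e] n) * (d * u / a) ^ n)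
    sums (1 / ?K * ?R)"
    using u(1) nz e0 by simp
  then have "phi32 a b c d e q (d * u / a) = 1 / ?K * ?R"
    unfolding phi32_def by (rule sums_unique[symmetric])
  also have "\<dots> = qpoch_inf q (b * u) * qpoch_inf q (c * u) / (qpoch_inf q e * qpoch_inf q u) * ?\<phi>1
    + qpoch_inf q b * qpoch_inf q c * qpoch_inf q (d / a) * qpoch_inf q (d * u)
        / (qpoch_inf q d * qpoch_inf q e * qpoch_inf q (1 / u) * qpoch_inf q (d * u / a)) * ?\<phi>2"
  proof -
    \<comment> \<open>The factor \<open>- u / (1 - u)\<close> is absorbed by \<open>(1/u; q)\<^sub>\<infinity> = (1 - 1/u) (q/u; q)\<^sub>\<infinity>\<close>.\<close>
    have "1 / ?K * (X - Y * (u * qpoch_inf q q * qpoch_inf q (q * u) * V * W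
               / (qpoch_inf q d * qpoch_inf q (d * u / a)) * Z))
       = 1 / ?K * X + Y * V * W
           / (qpoch_inf q d * qpoch_inf q e * qpoch_inf q (1 / u) * qpoch_inf q (d * u / a)) * Z"
      for X Y V W Z
      unfolding uu using u0 nz e0 d duz by (simp add: divide_simps) (simp add: algebra_simps)
    moreover have "1 / ?K * (X * (qpoch_inf q q * qpoch_inf q (q / u) * Z))
       = X / (qpoch_inf q e * qpoch_inf q u) * Z" for X Z
      using u nz e0 by (simp add: divide_simps)
    ultimately show ?thesis by simp
  qed
  finally show ?thesis .
qed

text \<open>
  The same relation with a free variable for each derived parameter, so that it can be applied to
  parameters in whatever form they are given.
\<close>
lemma three_term_relation:
  assumes "a \<noteq> 0" "u \<noteq> 0" "norm z < 1"
    and "qpoch_inf q d \<noteq> 0" "qpoch_inf q e \<noteq> 0" "qpoch_inf q du \<noteq> 0"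
      "qpoch_inf q u \<noteq> 0" "qpoch_inf q iu \<noteq> 0"
    and "e = b * c * u" "z = d * u / a" "du = d * u" "iu = 1 / u"
      "da = d / a" "bu = b * u" "cu = c * u" "qu = q * u" "qiu = q / u"
  shows "phi32 a b c d e q z =
    qpoch_inf q bu * qpoch_inf q cu / (qpoch_inf q e * qpoch_inf q u) * phi32 da b c d qiu q q
    + qpoch_inf q b * qpoch_inf q c * qpoch_inf q da * qpoch_inf q du
        / (qpoch_inf q d * qpoch_inf q e * qpoch_inf q iu * qpoch_inf q z)
      * phi32 bu cu z du qu q q"
  using nonterminating_phi32_three_term[of a u e b c d] assms by simp

end

section \<open>Theta functions\<close>

context q_series
begin

text \<open>
  \<open>(t; q)\<^sub>\<infinity>\<close> and \<open>(1/t; q)\<^sub>\<infinity>\<close> split off \<open>1 - t\<close> and \<open>1 - 1/t\<close>, whose quotient is \<open>- t\<close>; the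
  remaining products on the two sides are the same.
\<close>
lemma qtheta_inverse:
  assumes "t \<noteq> 0"
  shows "qtheta q t = - t * qtheta q (1 / t)"
proof -
  have "qtheta q t = (1 - t) * qpoch_inf q (q * t) * qpoch_inf q (q / t) * qpoch_inf q q"
    using qpoch_inf_step[of t] by (simp add: qtheta_def qpochs_inf_def mult_ac)
  moreover have "qtheta q (1 / t)
      = (1 - 1 / t) * qpoch_inf q (q * t) * qpoch_inf q (q / t) * qpoch_inf q q"
    using qpoch_inf_step[of "1 / t"] by (simp add: qtheta_def qpochs_inf_def mult_ac)
  ultimately show ?thesis using assms by (simp only:) (simp add: field_simps)
qed

text \<open>
  The coefficient of \<open>y\<^bsub>\<beta>1\<^esub>\<close> in the relation for \<open>f34\<close>, with \<open>Q = q\<^sup>\<lambda>\<close> and with \<open>p1\<close>, \<open>p2\<close> for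
  the powers of \<open>\<beta>1\<close>, \<open>\<beta>2\<close>. Inverting the arguments of three of the theta functions contributes the factor
  \<open>(- \<beta>1/\<beta>2) (- Q \<alpha>1/\<beta>1) / (- Q \<alpha>1/\<beta>2) = - 1\<close>, and all remaining products match those of the first
  summand.
\<close>
lemma connection_coefficient_vanishes:
  fixes \<alpha>1 \<alpha>2 \<beta>1 \<beta>2 Q p1 p2 :: complex
  assumes nz: "\<alpha>1 \<noteq> 0" "\<alpha>2 \<noteq> 0" "\<beta>1 \<noteq> 0" "\<beta>2 \<noteq> 0" "Q \<noteq> 0" "p1 \<noteq> 0" "p2 \<noteq> 0"
    and pf: "qpoch_inf q (\<alpha>2 / \<beta>1) \<noteq> 0" "qpoch_inf q (1 / Q * \<beta>1 / \<alpha>1) \<noteq> 0"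
      "qpoch_inf q (Q * q * \<alpha>1 / \<beta>1) \<noteq> 0"
    and th: "qtheta q (\<beta>2 / \<beta>1) \<noteq> 0" "qtheta q (\<alpha>2 / \<beta>2) \<noteq> 0" "qtheta q (Q * \<alpha>1 / \<beta>2) \<noteq> 0"
  shows "1 / p1 / (1 - q)
     * (qpochs_inf q [Q * \<alpha>1 * \<alpha>2 / (\<beta>2 * \<beta>1), \<beta>1 / \<alpha>1, q * \<beta>1 / \<alpha>2]
        / qpochs_inf q [Q * q * \<alpha>1 / \<beta>2, Q * \<alpha>2 / \<beta>2, q])
   + - (1 / p2 / (1 - q))
     * (qpochs_inf q [1 / Q * \<beta>2 / \<alpha>1, Q * \<alpha>1 * \<alpha>2 / (\<beta>1 * \<beta>2),
                      q * \<beta>2 / \<alpha>2, \<beta>1 / \<alpha>1, \<alpha>2 / \<beta>2]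
        / qpochs_inf q [Q * \<alpha>2 / \<beta>2, \<alpha>2 / \<beta>1, 1 / Q * \<beta>1 / \<alpha>1,
                        Q * q * \<alpha>1 / \<beta>1, q])
   * (- (p2 / p1)
     * ((qtheta q (\<beta>1 / \<beta>2) * qtheta q (\<alpha>2 / \<beta>1) * qtheta q (Q * \<alpha>1 / \<beta>1))
        / (qtheta q (\<beta>2 / \<beta>1) * qtheta q (\<alpha>2 / \<beta>2) * qtheta q (Q * \<alpha>1 / \<beta>2)))) = 0"
proof -
  have t1: "qtheta q (\<beta>1 / \<beta>2) = - (\<beta>1 / \<beta>2) * qtheta q (\<beta>2 / \<beta>1)"
    using qtheta_inverse[of "\<beta>1 / \<beta>2"] nz by simp
  have t2: "qtheta q (Q * \<alpha>1 / \<beta>)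
      = - (Q * \<alpha>1 / \<beta>) * (qpoch_inf q (1 / Q * \<beta> / \<alpha>1) * qpoch_inf q (Q * q * \<alpha>1 / \<beta>) * qpoch_inf q q)"
    if "\<beta> \<noteq> 0" for \<beta>
    using qtheta_inverse[of "Q * \<alpha>1 / \<beta>"] nz that
    by (simp add: qtheta_def qpochs_inf_def mult_ac)
  have t3: "qtheta q (\<alpha>2 / \<beta>) = qpoch_inf q (\<alpha>2 / \<beta>) * qpoch_inf q (q * \<beta> / \<alpha>2) * qpoch_inf q q" for \<beta>
    by (simp add: qtheta_def qpochs_inf_def mult_ac)
  have A: "Q * \<alpha>1 * \<alpha>2 / (\<beta>2 * \<beta>1) = Q * \<alpha>1 * \<alpha>2 / (\<beta>1 * \<beta>2)" by (simp add: mult.commute)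
  define t where "t = qtheta q (\<beta>2 / \<beta>1)"
  define P1 where "P1 = qpoch_inf q (\<alpha>2 / \<beta>1)"
  define P2 where "P2 = qpoch_inf q (1 / Q * \<beta>1 / \<alpha>1)"
  define P3 where "P3 = qpoch_inf q (Q * q * \<alpha>1 / \<beta>1)"
  define P4 where "P4 = qpoch_inf q (Q * \<alpha>1 * \<alpha>2 / (\<beta>1 * \<beta>2))"
  define P5 where "P5 = qpoch_inf q (\<beta>1 / \<alpha>1)"
  define P6 where "P6 = qpoch_inf q (q * \<beta>1 / \<alpha>2)"
  define P7 where "P7 = qpoch_inf q (Q * q * \<alpha>1 / \<beta>2)"
  define P8 where "P8 = qpoch_inf q (Q * \<alpha>2 / \<beta>2)"
  define P9 where "P9 = qpoch_inf q (1 / Q * \<beta>2 / \<alpha>1)"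
  define R1 where "R1 = qpoch_inf q (q * \<beta>2 / \<alpha>2)"
  define R2 where "R2 = qpoch_inf q (\<alpha>2 / \<beta>2)"
  define R3 where "R3 = qpoch_inf q q"
  note defs = t_def P1_def P2_def P3_def P4_def P5_def P6_def P7_def P8_def P9_def R1_def R2_def R3_def
  have "t \<noteq> 0" "P1 \<noteq> 0" "P2 \<noteq> 0" "P3 \<noteq> 0" "R3 \<noteq> 0" "P9 \<noteq> 0" "P7 \<noteq> 0" "R1 \<noteq> 0" "R2 \<noteq> 0"
    using th pf unfolding t2[OF nz(4)] t3 defs by (auto simp del: times_divide_eq_left)
  moreover have "1 - q \<noteq> 0" using q1 by auto
  ultimately show ?thesis
    unfolding t1 t2[OF nz(4)] t2[OF nz(3)] t3 A qpochs_inf_def list.map prod_list.Cons prod_list.Nil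
    unfolding defs[symmetric]
    \<comment> \<open>\<open>P8\<close> is a denominator of both summands and occurs nowhere else; if it is zero, both are zero.\<close>
    using nz by (cases "P8 = 0"; simp add: divide_simps; simp add: algebra_simps)
qed

end

section \<open>The connection relations\<close>

theorem proposition3p5:
  fixes L :: "complex \<Rightarrow> complex"
    and q \<alpha>1 \<alpha>2 \<beta>1 \<beta>2 lam \<mu>' x :: complex
  assumes "log_choice L"
    and "0 < norm q" and "norm q < 1"
    and "\<alpha>1 \<noteq> 0" and "\<alpha>2 \<noteq> 0" and "\<beta>1 \<noteq> 0" and "\<beta>2 \<noteq> 0"
    and "x \<noteq> 0"
    and "cpow L q \<mu>' * \<alpha>1 * \<alpha>2 / (\<beta>1 * \<beta>2) = 1"
    and "norm (cpow L q lam * \<alpha>1 * \<alpha>2 / (\<beta>1 * \<beta>2)) < 1"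
  shows
   "(pole_free q
       [\<beta>1 * x, \<beta>2 * x, cpow L q (- lam) * \<beta>1 * x, cpow L q (- lam) * \<beta>2 * x,
        \<alpha>1 * \<alpha>2 * x / \<beta>1,
        \<beta>1 / \<alpha>1, q * \<beta>1 / \<alpha>2, q * \<beta>1 / \<beta>2, \<beta>2 / \<alpha>1, q * \<beta>2 / \<alpha>2, q * \<beta>2 / \<beta>1,
        q * \<beta>1 * \<beta>2 / (\<alpha>1 * \<alpha>2), \<beta>1 * \<beta>2 / (\<alpha>1 * \<alpha>2),
        \<alpha>1 * \<alpha>2 / (\<beta>1 * \<beta>2), q * \<alpha>1 * \<alpha>2 / (\<beta>1 * \<beta>2),
        cpow L q (lam + 1) * \<alpha>1 / \<beta>1, cpow L q (lam + 1) * \<alpha>1 / \<beta>2,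
        cpow L q lam * \<alpha>2 / \<beta>2, \<alpha>2 / \<beta>1, cpow L q (- lam) * \<beta>1 / \<alpha>1] \<and>
     qtheta q (\<beta>2 / \<beta>1) \<noteq> 0 \<and> qtheta q (\<alpha>2 / \<beta>2) \<noteq> 0 \<and>
     qtheta q (cpow L q lam * \<alpha>1 / \<beta>2) \<noteq> 0 \<and>
     S3 L q \<alpha>1 \<alpha>2 \<beta>1 \<beta>2 lam \<noteq> 0 \<and> A11 L q \<alpha>1 \<alpha>2 \<beta>1 \<beta>2 lam \<noteq> 0
     \<longrightarrow>
     f34 L q \<alpha>1 \<alpha>2 \<beta>1 \<beta>2 lam x
       - C1 L q \<alpha>1 \<alpha>2 \<beta>1 \<beta>2 lam x / S3 L q \<alpha>1 \<alpha>2 \<beta>1 \<beta>2 lam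
     = - ((S1_check L q \<alpha>1 \<alpha>2 \<beta>1 \<beta>2 lam \<mu>'
             + A12 L q \<alpha>1 \<alpha>2 \<beta>1 \<beta>2 lam \<mu>' * K63 L q \<alpha>1 \<alpha>2 \<beta>1 \<beta>2 lam \<mu>')
            / (A11 L q \<alpha>1 \<alpha>2 \<beta>1 \<beta>2 lam * S3 L q \<alpha>1 \<alpha>2 \<beta>1 \<beta>2 lam)
            * y_beta L q \<alpha>1 \<alpha>2 \<beta>1 \<beta>2 lam \<mu>' x
          - A12 L q \<alpha>1 \<alpha>2 \<beta>1 \<beta>2 lam \<mu>'
            / (A11 L q \<alpha>1 \<alpha>2 \<beta>1 \<beta>2 lam * S3 L q \<alpha>1 \<alpha>2 \<beta>1 \<beta>2 lam)
            * y_beta L q \<alpha>1 \<alpha>2 \<beta>2 \<beta>1 lam \<mu>' x))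
    \<and>
    (pole_free q
       [\<beta>2 * x, cpow L q (- lam) * \<beta>2 * x,
        \<beta>2 / \<alpha>1, q * \<beta>2 / \<alpha>2, q * \<beta>2 / \<beta>1, \<alpha>2 / \<beta>1,
        cpow L q (lam + 1) * \<alpha>1 / \<beta>1, cpow L q (lam + 1) * \<alpha>1 / \<beta>2,
        cpow L q lam * \<alpha>2 / \<beta>1, cpow L q lam * \<alpha>1 / \<beta>2,
        cpow L q (- lam + 1) * \<beta>2 / \<alpha>1, cpow L q (- lam) * \<beta>2 / \<alpha>1] \<and>
     S4 L q \<alpha>1 \<alpha>2 \<beta>1 \<beta>2 lam \<noteq> 0
     \<longrightarrow>
     f37 L q \<alpha>1 \<alpha>2 \<beta>1 \<beta>2 lam x
       - C2 L q \<alpha>1 \<alpha>2 \<beta>1 \<beta>2 lam x / S4 L q \<alpha>1 \<alpha>2 \<beta>1 \<beta>2 lam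
     = - (S1 L q \<alpha>1 \<alpha>2 \<beta>1 \<beta>2 lam \<mu>' / S4 L q \<alpha>1 \<alpha>2 \<beta>1 \<beta>2 lam
          * y_beta L q \<alpha>1 \<alpha>2 \<beta>2 \<beta>1 lam \<mu>' x))
    \<and>
    (pole_free q
       [\<beta>2 * x / q, cpow L q (- lam) * \<beta>1 * x,
        q / (\<alpha>1 * x), q\<^sup>2 / (\<alpha>2 * x), q\<^sup>2 / (\<beta>1 * x), q\<^sup>2 / (\<beta>2 * x),
        cpow L q (- lam - 1) * \<beta>1 * \<beta>2 * x / \<alpha>1,
        cpow L q (lam + 2) * \<alpha>1 / (\<beta>1 * \<beta>2 * x),
        cpow L q (- lam + 1),
        cpow L q (- lam + 1) * \<beta>1 / \<alpha>1, cpow L q (- lam) * \<beta>1 / \<alpha>1,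
        cpow L q (lam + 1) * \<alpha>1 / \<beta>1, cpow L q lam * \<alpha>1 / \<beta>1,
        q * \<alpha>1 * \<alpha>2 / (\<beta>1 * \<beta>2)] \<and>
     qtheta q (cpow L q (- lam - 1) * \<beta>1 * \<beta>2 * x / \<alpha>1) \<noteq> 0 \<and> qtheta q (\<alpha>1 * x) \<noteq> 0 \<and>
     S5 L q \<alpha>1 \<alpha>2 \<beta>1 \<beta>2 lam x \<noteq> 0
     \<longrightarrow>
     f36 L q \<alpha>1 \<alpha>2 \<beta>1 \<beta>2 lam x
       - C3 L q \<alpha>1 \<alpha>2 \<beta>1 \<beta>2 lam x / S5 L q \<alpha>1 \<alpha>2 \<beta>1 \<beta>2 lam x
     = - (S2 L q \<alpha>1 \<alpha>2 \<beta>1 \<beta>2 lam \<mu>' x / S5 L q \<alpha>1 \<alpha>2 \<beta>1 \<beta>2 lam x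
          * y_x L q \<alpha>1 \<alpha>2 \<beta>1 \<beta>2 lam \<mu>' x))"
proof -
  interpret q_series q
    by unfold_locales (use assms in auto)
  define Q where "Q = cpow L q lam"
  define p0 where "p0 = cpow L q (lam - \<mu>')"
  define p1 where "p1 = cpow L \<beta>1 (lam - \<mu>')"
  define p2 where "p2 = cpow L \<beta>2 (lam - \<mu>')"
  define X where "X = cpow L x lam"
  have nz: "Q \<noteq> 0" "p0 \<noteq> 0" "p1 \<noteq> 0" "p2 \<noteq> 0" "X \<noteq> 0" "1 - q \<noteq> 0"
    using assms(3) by (auto simp: Q_def p0_def p1_def p2_def X_def cpow_def)
  have Lq: "exp (L q) = q" using assms(1) q0 by (simp add: log_choice_def)
  have L2: "exp (L q * 2) = q * q"
    using exp_double[of "L q"] Lq by (simp add: mult.commute power2_eq_square)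
  have cp: "cpow L q (- lam) = 1 / Q" "cpow L q (lam + 1) = Q * q" "cpow L q (lam + 2) = Q * q\<^sup>2"
    "cpow L q (- lam + 1) = q / Q" "cpow L q (- lam - 1) = 1 / (Q * q)"
    "cpow L q (- lam + \<mu>') = 1 / p0" "cpow L \<beta>1 (- lam + \<mu>') = 1 / p1"
    "cpow L \<beta>2 (- lam + \<mu>') = 1 / p2"
    using Lq L2 by (simp_all add: Q_def p0_def p1_def p2_def cpow_def ring_distribs exp_add exp_diff
        exp_minus exp_double mult.commute[of _ "L q"] divide_inverse power2_eq_square)
  have xx: "cpow L x (lam - \<mu>') * cpow L x \<mu>' = X"
    by (simp add: X_def cpow_def exp_add[symmetric] ring_distribs)
  note folds = Q_def[symmetric] p0_def[symmetric] p1_def[symmetric] p2_def[symmetric] X_def[symmetric]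
  have z: "norm (Q * \<alpha>1 * \<alpha>2 / (\<beta>1 * \<beta>2)) < 1" using assms(10) by (simp add: Q_def)
  have pz: "qpoch_inf q (Q * \<alpha>1 * \<alpha>2 / (\<beta>1 * \<beta>2)) \<noteq> 0" "qpoch_inf q q \<noteq> 0"
    using qpoch_inf_nonzero[OF z] by simp_all
  note ab = \<open>\<alpha>1 \<noteq> 0\<close> \<open>\<alpha>2 \<noteq> 0\<close> \<open>\<beta>1 \<noteq> 0\<close> \<open>\<beta>2 \<noteq> 0\<close> \<open>x \<noteq> 0\<close>
  note pf_simps = pole_free_def list.set ball_simps
  note unroll = qpochs_inf_def list.map prod_list.Cons prod_list.Nil mult_1_right
  \<comment> \<open>In each case \<open>Pb\<close>, \<open>Pdu\<close>, ... denote the infinite products belonging to the quantities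
    \<open>b\<close>, \<open>du\<close>, ... of \<open>three_term_relation\<close>; the remaining symbols stand for further products and
    for the three series. With these opaque symbols the claim is an identity of rational functions.\<close>
  \<comment> \<open>In each case \<open>Pb\<close>, \<open>Pdu\<close>, ... denote the infinite products belonging to the quantities
    \<open>b\<close>, \<open>du\<close>, ... of \<open>three_term_relation\<close>; the remaining symbols stand for further products and
    for the three series. With these opaque symbols the claim is an identity of rational functions.\<close>
  show ?thesis
    unfolding folds cp
  proof (intro conjI impI, goal_cases)
    case 1
    from 1 have pf0:
        "qpoch_inf q (\<beta>2 * x) \<noteq> 0" "qpoch_inf q (1 / Q * \<beta>2 * x) \<noteq> 0"
        "qpoch_inf q (\<alpha>1 * \<alpha>2 * x / \<beta>1) \<noteq> 0"
        "qpoch_inf q (\<beta>2 / \<alpha>1) \<noteq> 0"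
        "qpoch_inf q (q * \<beta>2 / \<alpha>2) \<noteq> 0"
        "qpoch_inf q (q * \<beta>2 / \<beta>1) \<noteq> 0"
        "qpoch_inf q (q * \<beta>1 * \<beta>2 / (\<alpha>1 * \<alpha>2)) \<noteq> 0"
        "qpoch_inf q (\<beta>1 * \<beta>2 / (\<alpha>1 * \<alpha>2)) \<noteq> 0"
        "qpoch_inf q (\<alpha>1 * \<alpha>2 / (\<beta>1 * \<beta>2)) \<noteq> 0"
        "qpoch_inf q (q * \<alpha>1 * \<alpha>2 / (\<beta>1 * \<beta>2)) \<noteq> 0"
        "qpoch_inf q (Q * q * \<alpha>1 / \<beta>1) \<noteq> 0"
        "qpoch_inf q (Q * \<alpha>2 / \<beta>2) \<noteq> 0"
        "qpoch_inf q (\<alpha>2 / \<beta>1) \<noteq> 0"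
        "qpoch_inf q (1 / Q * \<beta>1 / \<alpha>1) \<noteq> 0"
      and th: "qtheta q (\<beta>2 / \<beta>1) \<noteq> 0" "qtheta q (\<alpha>2 / \<beta>2) \<noteq> 0" "qtheta q (Q * \<alpha>1 / \<beta>2) \<noteq> 0"
      and S: "S3 L q \<alpha>1 \<alpha>2 \<beta>1 \<beta>2 lam \<noteq> 0" and A: "A11 L q \<alpha>1 \<alpha>2 \<beta>1 \<beta>2 lam \<noteq> 0"
      unfolding pf_simps by blast+
    have pf1: "qpoch_inf q (q * \<alpha>1 / \<beta>1) \<noteq> 0"
      using S unfolding S3_def folds cp unroll by auto
    have pf2: "qpoch_inf q (\<beta>1 / \<alpha>1) \<noteq> 0" "qpoch_inf q (\<alpha>2 / \<beta>2) \<noteq> 0"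
        "qpoch_inf q (1 / Q * \<beta>2 / \<alpha>1) \<noteq> 0"
      using A unfolding A11_def folds cp unroll by auto
    note pf = pf0 pf1 pf2
    have no_y_beta1: "S1_check L q \<alpha>1 \<alpha>2 \<beta>1 \<beta>2 lam \<mu>'
        + A12 L q \<alpha>1 \<alpha>2 \<beta>1 \<beta>2 lam \<mu>' * K63 L q \<alpha>1 \<alpha>2 \<beta>1 \<beta>2 lam \<mu>' = 0"
      unfolding S1_check_def S1_def A12_def K63_def folds cp
      by (rule connection_coefficient_vanishes) (fact ab nz pf th)+
    define Pb where "Pb = qpoch_inf q (\<beta>2 / \<alpha>1)"
    define Pc where "Pc = qpoch_inf q (q * \<beta>2 / \<alpha>2)"
    define Pd where "Pd = qpoch_inf q (\<beta>2 * x)"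
    define Pe where "Pe = qpoch_inf q (q * \<beta>2 / \<beta>1)"
    define Pu where "Pu = qpoch_inf q (\<alpha>1 * \<alpha>2 / (\<beta>1 * \<beta>2))"
    define Piu where "Piu = qpoch_inf q (\<beta>1 * \<beta>2 / (\<alpha>1 * \<alpha>2))"
    define Pda where "Pda = qpoch_inf q Q"
    define Pdu where "Pdu = qpoch_inf q (\<alpha>1 * \<alpha>2 * x / \<beta>1)"
    define Pbu where "Pbu = qpoch_inf q (\<alpha>2 / \<beta>1)"
    define Pcu where "Pcu = qpoch_inf q (q * \<alpha>1 / \<beta>1)"
    define Pz where "Pz = qpoch_inf q (Q * \<alpha>1 * \<alpha>2 / (\<beta>1 * \<beta>2))"
    define Pa where "Pa = qpoch_inf q (1 / Q * \<beta>2 * x)"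
    define P1 where "P1 = qpoch_inf q (Q * q * \<alpha>1 / \<beta>1)"
    define P2 where "P2 = qpoch_inf q (\<beta>1 / \<alpha>1)"
    define P3 where "P3 = qpoch_inf q (\<alpha>2 / \<beta>2)"
    define P4 where "P4 = qpoch_inf q (1 / Q * \<beta>2 / \<alpha>1)"
    define P5 where "P5 = qpoch_inf q (Q * \<alpha>2 / \<beta>2)"
    define P6 where "P6 = qpoch_inf q (1 / Q * \<beta>1 / \<alpha>1)"
    define Pq where "Pq = qpoch_inf q q"
    define Y where "Y = phi32 (1 / Q * \<beta>2 * x) (\<beta>2 / \<alpha>1) (q * \<beta>2 / \<alpha>2) (\<beta>2 * x) (q * \<beta>2 / \<beta>1) q (Q * \<alpha>1 * \<alpha>2 / (\<beta>1 * \<beta>2))"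
    define G where "G = phi32 (\<beta>2 / \<alpha>1) (q * \<beta>2 / \<alpha>2) Q (q * \<beta>1 * \<beta>2 / (\<alpha>1 * \<alpha>2)) (\<beta>2 * x) q q"
    define F where "F = phi32 (Q * \<alpha>1 * \<alpha>2 / (\<beta>1 * \<beta>2)) (q * \<alpha>1 / \<beta>1) (\<alpha>2 / \<beta>1) (\<alpha>1 * \<alpha>2 * x / \<beta>1) (q * \<alpha>1 * \<alpha>2 / (\<beta>1 * \<beta>2)) q q"
    note P_defs =
      Pb_def Pc_def Pd_def Pe_def Pu_def Piu_def Pda_def Pdu_def Pbu_def Pcu_def Pz_def Pa_def
      P1_def P2_def P3_def P4_def P5_def P6_def Pq_def
    note symbols = P_defs Y_def G_def F_def
    note fold_symbols = symbols[symmetric]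
    have nonzero:
      "Pb \<noteq> 0" "Pc \<noteq> 0" "Pd \<noteq> 0" "Pe \<noteq> 0" "Pu \<noteq> 0"
      "Piu \<noteq> 0" "Pdu \<noteq> 0" "Pbu \<noteq> 0" "Pcu \<noteq> 0" "Pz \<noteq> 0"
      "Pa \<noteq> 0" "P1 \<noteq> 0" "P2 \<noteq> 0" "P3 \<noteq> 0" "P4 \<noteq> 0"
      "P5 \<noteq> 0" "P6 \<noteq> 0" "Pq \<noteq> 0"
      using pf pz unfolding P_defs by blast+
    have Y_eq: "Y = Pbu * Pcu / (Pe * Pu) * G + Pb * Pc * Pda * Pdu / (Pd * Pe * Piu * Pz) * F"
    proof -
      \<comment> \<open>Here \<open>u = \<alpha>1 \<alpha>2 / (\<beta>1 \<beta>2)\<close>; only the solution attached to \<open>\<beta>2\<close> enters.\<close>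
      have "phi32 (1 / Q * \<beta>2 * x) (\<beta>2 / \<alpha>1) (q * \<beta>2 / \<alpha>2) (\<beta>2 * x) (q * \<beta>2 / \<beta>1) q (Q * \<alpha>1 * \<alpha>2 / (\<beta>1 * \<beta>2))
        = Pbu * Pcu / (Pe * Pu)
            * phi32 Q (\<beta>2 / \<alpha>1) (q * \<beta>2 / \<alpha>2) (\<beta>2 * x) (q * \<beta>1 * \<beta>2 / (\<alpha>1 * \<alpha>2)) q q
          + Pb * Pc * Pda * Pdu / (Pd * Pe * Piu * Pz)
            * phi32 (\<alpha>2 / \<beta>1) (q * \<alpha>1 / \<beta>1) (Q * \<alpha>1 * \<alpha>2 / (\<beta>1 * \<beta>2)) (\<alpha>1 * \<alpha>2 * x / \<beta>1) (q * \<alpha>1 * \<alpha>2 / (\<beta>1 * \<beta>2)) q q"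
        unfolding P_defs
        by (rule three_term_relation)
           ((fact pf z | (use ab q0 nz in \<open>simp add: field_simps power2_eq_square; fail\<close>))+)
      then show ?thesis
        unfolding Y_def G_def F_def by (simp only: phi32_swap12 phi32_swap23 phi32_swap_lower)
    qed
    show ?case
      unfolding no_y_beta1
      unfolding f34_def C1_def S3_def A11_def A12_def y_beta_def folds cp mult.commute[of \<beta>2 \<beta>1] unroll
      unfolding fold_symbols Y_eq
      using nz nonzero by (simp add: divide_simps) (simp add: algebra_simps)
  next
    case 2
    from 2 have pf:
        "qpoch_inf q (\<beta>2 * x) \<noteq> 0" "qpoch_inf q (1 / Q * \<beta>2 * x) \<noteq> 0"
        "qpoch_inf q (\<beta>2 / \<alpha>1) \<noteq> 0"
        "qpoch_inf q (q * \<beta>2 / \<alpha>2) \<noteq> 0"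
        "qpoch_inf q (q * \<beta>2 / \<beta>1) \<noteq> 0"
        "qpoch_inf q (\<alpha>2 / \<beta>1) \<noteq> 0"
        "qpoch_inf q (Q * q * \<alpha>1 / \<beta>1) \<noteq> 0"
        "qpoch_inf q (Q * q * \<alpha>1 / \<beta>2) \<noteq> 0"
        "qpoch_inf q (Q * \<alpha>2 / \<beta>1) \<noteq> 0"
        "qpoch_inf q (Q * \<alpha>1 / \<beta>2) \<noteq> 0"
        "qpoch_inf q (q / Q * \<beta>2 / \<alpha>1) \<noteq> 0"
        "qpoch_inf q (1 / Q * \<beta>2 / \<alpha>1) \<noteq> 0"
      unfolding pf_simps by blast+
    define Pb where "Pb = qpoch_inf q (\<beta>2 / \<alpha>1)"
    define Pc where "Pc = qpoch_inf q (1 / Q * \<beta>2 * x)"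
    define Pd where "Pd = qpoch_inf q (q * \<beta>2 / \<beta>1)"
    define Pe where "Pe = qpoch_inf q (\<beta>2 * x)"
    define Pu where "Pu = qpoch_inf q (Q * \<alpha>1 / \<beta>2)"
    define Piu where "Piu = qpoch_inf q (1 / Q * \<beta>2 / \<alpha>1)"
    define Pda where "Pda = qpoch_inf q (\<alpha>2 / \<beta>1)"
    define Pdu where "Pdu = qpoch_inf q (Q * q * \<alpha>1 / \<beta>1)"
    define Pbu where "Pbu = qpoch_inf q Q"
    define Pcu where "Pcu = qpoch_inf q (\<alpha>1 * x)"
    define Pz where "Pz = qpoch_inf q (Q * \<alpha>1 * \<alpha>2 / (\<beta>1 * \<beta>2))"
    define Pa where "Pa = qpoch_inf q (q * \<beta>2 / \<alpha>2)"
    define P1 where "P1 = qpoch_inf q (Q * \<alpha>2 / \<beta>1)"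
    define Pq where "Pq = qpoch_inf q q"
    define Y where "Y = phi32 (1 / Q * \<beta>2 * x) (\<beta>2 / \<alpha>1) (q * \<beta>2 / \<alpha>2) (\<beta>2 * x) (q * \<beta>2 / \<beta>1) q (Q * \<alpha>1 * \<alpha>2 / (\<beta>1 * \<beta>2))"
    define G where "G = phi32 (\<beta>2 / \<alpha>1) (\<alpha>2 / \<beta>1) (1 / Q * \<beta>2 * x) (q * \<beta>2 / \<beta>1) (q / Q * \<beta>2 / \<alpha>1) q q"
    define F where "F = phi32 (Q * \<alpha>1 * \<alpha>2 / (\<beta>1 * \<beta>2)) Q (\<alpha>1 * x) (Q * q * \<alpha>1 / \<beta>1) (Q * q * \<alpha>1 / \<beta>2) q q"
    note P_defs =
      Pb_def Pc_def Pd_def Pe_def Pu_def Piu_def Pda_def Pdu_def Pbu_def Pcu_def Pz_def Pa_def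
      P1_def Pq_def
    note symbols = P_defs Y_def G_def F_def
    note fold_symbols = symbols[symmetric]
    have nonzero:
      "Pb \<noteq> 0" "Pc \<noteq> 0" "Pd \<noteq> 0" "Pe \<noteq> 0" "Pu \<noteq> 0"
      "Piu \<noteq> 0" "Pda \<noteq> 0" "Pdu \<noteq> 0" "Pz \<noteq> 0" "Pa \<noteq> 0"
      "P1 \<noteq> 0" "Pq \<noteq> 0"
      using pf pz unfolding P_defs by blast+
    have Y_eq: "Y = Pbu * Pcu / (Pe * Pu) * G + Pb * Pc * Pda * Pdu / (Pd * Pe * Piu * Pz) * F"
    proof -
      \<comment> \<open>Here \<open>u = Q \<alpha>1 / \<beta>2\<close>. The products \<open>Pbu\<close> and \<open>Pcu\<close>, that is
        \<open>(Q; q)\<^sub>\<infinity>\<close> and \<open>(\<alpha>1 x; q)\<^sub>\<infinity>\<close>, may be zero here.\<close>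
      have "phi32 (q * \<beta>2 / \<alpha>2) (\<beta>2 / \<alpha>1) (1 / Q * \<beta>2 * x) (q * \<beta>2 / \<beta>1) (\<beta>2 * x) q (Q * \<alpha>1 * \<alpha>2 / (\<beta>1 * \<beta>2))
        = Pbu * Pcu / (Pe * Pu)
            * phi32 (\<alpha>2 / \<beta>1) (\<beta>2 / \<alpha>1) (1 / Q * \<beta>2 * x) (q * \<beta>2 / \<beta>1) (q / Q * \<beta>2 / \<alpha>1) q q
          + Pb * Pc * Pda * Pdu / (Pd * Pe * Piu * Pz)
            * phi32 Q (\<alpha>1 * x) (Q * \<alpha>1 * \<alpha>2 / (\<beta>1 * \<beta>2)) (Q * q * \<alpha>1 / \<beta>1) (Q * q * \<alpha>1 / \<beta>2) q q"
        unfolding P_defs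
        by (rule three_term_relation)
           ((fact pf z | (use ab q0 nz in \<open>simp add: field_simps power2_eq_square; fail\<close>))+)
      then show ?thesis
        unfolding Y_def G_def F_def by (simp only: phi32_swap12 phi32_swap23 phi32_swap_lower)
    qed
    show ?case
      unfolding f37_def C2_def S4_def S1_def y_beta_def folds cp mult.commute[of \<beta>2 \<beta>1] unroll
      unfolding fold_symbols Y_eq
      using nz nonzero by (simp add: divide_simps) (simp add: algebra_simps)
  next
    case 3
    from 3 have pf0:
        "qpoch_inf q (\<beta>2 * x / q) \<noteq> 0"
        "qpoch_inf q (1 / Q * \<beta>1 * x) \<noteq> 0"
        "qpoch_inf q (q / (\<alpha>1 * x)) \<noteq> 0"
        "qpoch_inf q (q\<^sup>2 / (\<alpha>2 * x)) \<noteq> 0"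
        "qpoch_inf q (q\<^sup>2 / (\<beta>1 * x)) \<noteq> 0"
        "qpoch_inf q (q\<^sup>2 / (\<beta>2 * x)) \<noteq> 0"
        "qpoch_inf q (Q * q\<^sup>2 * \<alpha>1 / (\<beta>1 * \<beta>2 * x)) \<noteq> 0"
        "qpoch_inf q (q / Q) \<noteq> 0" "qpoch_inf q (q / Q * \<beta>1 / \<alpha>1) \<noteq> 0"
        "qpoch_inf q (1 / Q * \<beta>1 / \<alpha>1) \<noteq> 0"
        "qpoch_inf q (Q * q * \<alpha>1 / \<beta>1) \<noteq> 0"
        "qpoch_inf q (Q * \<alpha>1 / \<beta>1) \<noteq> 0"
        "qpoch_inf q (q * \<alpha>1 * \<alpha>2 / (\<beta>1 * \<beta>2)) \<noteq> 0"
      and th: "qtheta q (1 / (Q * q) * \<beta>1 * \<beta>2 * x / \<alpha>1) \<noteq> 0" "qtheta q (\<alpha>1 * x) \<noteq> 0"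
      and S: "S5 L q \<alpha>1 \<alpha>2 \<beta>1 \<beta>2 lam x \<noteq> 0"
      unfolding pf_simps by blast+
    have args: "q / (\<alpha>2 * x / q) = q\<^sup>2 / (\<alpha>2 * x)" "q / (1 / Q * \<beta>1 * x) = Q * q / (\<beta>1 * x)"
      "q / (\<beta>2 * x / q) = q\<^sup>2 / (\<beta>2 * x)"
      "q / (1 / (Q * q) * \<beta>1 * \<beta>2 * x / \<alpha>1) = Q * q\<^sup>2 * \<alpha>1 / (\<beta>1 * \<beta>2 * x)"
      using ab q0 nz by (simp_all add: field_simps power2_eq_square)
    have pf1: "qpoch_inf q (q * \<alpha>1 / \<beta>1) \<noteq> 0" "qpoch_inf q (Q * q / (\<beta>1 * x)) \<noteq> 0"
      using S unfolding S5_def qtheta_def folds cp args unroll by auto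
    have pf2: "qpoch_inf q (\<alpha>1 * x) \<noteq> 0"
        "qpoch_inf q (1 / (Q * q) * \<beta>1 * \<beta>2 * x / \<alpha>1) \<noteq> 0"
      using th unfolding qtheta_def unroll by auto
    note pf = pf0 pf1 pf2
    define Pb where "Pb = qpoch_inf q (q / Q)"
    define Pc where "Pc = qpoch_inf q (q / (\<alpha>1 * x))"
    define Pd where "Pd = qpoch_inf q (q\<^sup>2 / (\<beta>2 * x))"
    define Pe where "Pe = qpoch_inf q (q\<^sup>2 / (\<beta>1 * x))"
    define Pu where "Pu = qpoch_inf q (Q * \<alpha>1 / \<beta>1)"
    define Piu where "Piu = qpoch_inf q (1 / Q * \<beta>1 / \<alpha>1)"
    define Pda where "Pda = qpoch_inf q (\<alpha>2 / \<beta>2)"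
    define Pdu where "Pdu = qpoch_inf q (Q * q\<^sup>2 * \<alpha>1 / (\<beta>1 * \<beta>2 * x))"
    define Pbu where "Pbu = qpoch_inf q (q * \<alpha>1 / \<beta>1)"
    define Pcu where "Pcu = qpoch_inf q (Q * q / (\<beta>1 * x))"
    define Pz where "Pz = qpoch_inf q (Q * \<alpha>1 * \<alpha>2 / (\<beta>1 * \<beta>2))"
    define Pa where "Pa = qpoch_inf q (q\<^sup>2 / (\<alpha>2 * x))"
    define P1 where "P1 = qpoch_inf q (\<alpha>1 * x)"
    define P2 where "P2 = qpoch_inf q (\<alpha>2 * x / q)"
    define P3 where "P3 = qpoch_inf q (\<beta>2 * x / q)"
    define P4 where "P4 = qpoch_inf q (1 / Q * \<beta>1 * x)"
    define P5 where "P5 = qpoch_inf q (q * \<alpha>1 * \<alpha>2 / (\<beta>1 * \<beta>2))"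
    define P6 where "P6 = qpoch_inf q (1 / (Q * q) * \<beta>1 * \<beta>2 * x / \<alpha>1)"
    define Pq where "Pq = qpoch_inf q q"
    define s1 where "s1 = cpow L x (lam - \<mu>')"
    define s2 where "s2 = cpow L x \<mu>'"
    define Y where "Y = phi32 (q / Q) (q / (\<alpha>1 * x)) (q\<^sup>2 / (\<alpha>2 * x)) (q\<^sup>2 / (\<beta>1 * x)) (q\<^sup>2 / (\<beta>2 * x)) q (Q * \<alpha>1 * \<alpha>2 / (\<beta>1 * \<beta>2))"
    define G where "G = phi32 (q / Q) (\<alpha>2 / \<beta>2) (q / (\<alpha>1 * x)) (q / Q * \<beta>1 / \<alpha>1) (q\<^sup>2 / (\<beta>2 * x)) q q"
    define F where "F = phi32 (Q * q / (\<beta>1 * x)) (Q * \<alpha>1 * \<alpha>2 / (\<beta>1 * \<beta>2)) (q * \<alpha>1 / \<beta>1) (Q * q\<^sup>2 * \<alpha>1 / (\<beta>1 * \<beta>2 * x)) (Q * q * \<alpha>1 / \<beta>1) q q"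
    note P_defs =
      Pb_def Pc_def Pd_def Pe_def Pu_def Piu_def Pda_def Pdu_def Pbu_def Pcu_def Pz_def Pa_def
      P1_def P2_def P3_def P4_def P5_def P6_def Pq_def
    note symbols = P_defs s1_def s2_def Y_def G_def F_def
    note fold_symbols = symbols[symmetric]
    have nonzero:
      "Pb \<noteq> 0" "Pc \<noteq> 0" "Pd \<noteq> 0" "Pe \<noteq> 0" "Pu \<noteq> 0"
      "Piu \<noteq> 0" "Pdu \<noteq> 0" "Pbu \<noteq> 0" "Pcu \<noteq> 0" "Pz \<noteq> 0"
      "Pa \<noteq> 0" "P1 \<noteq> 0" "P3 \<noteq> 0" "P4 \<noteq> 0" "P5 \<noteq> 0"
      "P6 \<noteq> 0" "Pq \<noteq> 0"
      using pf pz unfolding P_defs by blast+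
    have powers: "s1 \<noteq> 0" "s2 \<noteq> 0" by (simp_all add: s1_def s2_def cpow_def)
    have Y_eq: "Y = Pbu * Pcu / (Pe * Pu) * G + Pb * Pc * Pda * Pdu / (Pd * Pe * Piu * Pz) * F"
    proof -
      \<comment> \<open>Here \<open>u = Q \<alpha>1 / \<beta>1\<close>.\<close>
      have "phi32 (q\<^sup>2 / (\<alpha>2 * x)) (q / Q) (q / (\<alpha>1 * x)) (q\<^sup>2 / (\<beta>2 * x)) (q\<^sup>2 / (\<beta>1 * x)) q (Q * \<alpha>1 * \<alpha>2 / (\<beta>1 * \<beta>2))
        = Pbu * Pcu / (Pe * Pu)
            * phi32 (\<alpha>2 / \<beta>2) (q / Q) (q / (\<alpha>1 * x)) (q\<^sup>2 / (\<beta>2 * x)) (q / Q * \<beta>1 / \<alpha>1) q q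
          + Pb * Pc * Pda * Pdu / (Pd * Pe * Piu * Pz)
            * phi32 (q * \<alpha>1 / \<beta>1) (Q * q / (\<beta>1 * x)) (Q * \<alpha>1 * \<alpha>2 / (\<beta>1 * \<beta>2)) (Q * q\<^sup>2 * \<alpha>1 / (\<beta>1 * \<beta>2 * x)) (Q * q * \<alpha>1 / \<beta>1) q q"
        unfolding P_defs
        by (rule three_term_relation)
           ((fact pf z | (use ab q0 nz in \<open>simp add: field_simps power2_eq_square; fail\<close>))+)
      then show ?thesis
        unfolding Y_def G_def F_def by (simp only: phi32_swap12 phi32_swap23 phi32_swap_lower)
    qed
    show ?case
      unfolding f36_def C3_def S5_def S2_def y_x_def qtheta_def folds cp mult.commute[of \<beta>2 \<beta>1] args xx[symmetric] unroll
      unfolding fold_symbols Y_eq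
      using nz nonzero powers by (simp add: divide_simps) (simp add: algebra_simps)
  qed
qed

end
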